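(* Let $G$ be a finitely generated group and $H \leq G$ a subgroup. (1) If $H$ is codimension-one, then it is coarsely separating. (2) If $2 \leq \tilde{e}(G,H) \leq \omega$, then $H$ is virtually codimension-one. (3) If $H$ is an ERF group, then $H$ is coarsely separating if and only if it is virtually codimension-one. (4) If $H$ is coarsely separating, then it contains a codimension-one subgroup of $G$. (5) If $H$ is coarsely separating, then it may have no finite-index subgroup that has codimension one in $G$; that is, there exist a finitely generated group $G$ and a coarsely separating subgroup $H \leq G$ such that no finite-index subgroup of $H$ is a codimension-one subgroup of $G$.
   Context: Fix a finite generating set $S$ of $G$; $G$ is viewed as its Cayley graph (edges connect $g$ and $gs$, $s\in S$). The Schreier graph $\mathrm{Sch}(G,H)$ has vertices the cosets $Hg$ ($g \in G$) and edges connecting $Hg$ and $Hgs$ ($g\in G$, $s \in S$). The number of ends of a graph is the maximal number, possibly infinite, of unbounded components in the complement of a ball. $e(G,H)$ is the number of ends of $\mathrm{Sch}(G,H)$. For a graph $X$ and a subgraph $Y$, $Y^{+L}$ is the $L$-neighbourhood of $Y$, and a connected component of $X \setminus Y^{+L}$ is deep if it contains vertices arbitrarily far away from $Y$. The number of coends $\tilde e(X,Y)$ is: the maximal number of deep components of $X\setminus Y^{+L}$ for $L \geq 0$ if this quantity is finite; $\omega$ if $X\setminus Y^{+L}$ can have an arbitrarily large number of deep components, but always finite, for $L \geq 0$; $\omega+1$ if there is $L\geq 0$ such that $X\setminus Y^{+L}$ has infinitely many deep components. These values are ordered as ordinals. Neither $e(G,H)$ nor $\tilde e(G,H)$ depends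 on the choice of $S$. $H$ is a codimension-one subgroup of $G$ if $e(G,H) \geq 2$; it is a coarsely separating subgroup of $G$ if $\tilde e(G,H) \geq 2$; it is virtually codimension-one if some finite-index subgroup of $H$ is a codimension-one subgroup of $G$. A subgroup $K$ of a group $A$ is separable if, for every $a \in A \setminus K$, there is a finite-index subgroup of $A$ that contains $K$ but not $a$. A group all of whose subgroups are separable is ERF (Extended Residually Finite). *)

theory Defs
  imports "HOL-Algebra.Algebra" "HOL-Library.Extended_Nat"
begin

text \<open>A graph is given by a vertex set \<open>V\<close> and a symmetric relation \<open>E\<close> on \<open>V\<close>. Loops are
  allowed: they affect neither distances nor components.\<close>

definition nbhd :: "'v set \<Rightarrow> 'v rel \<Rightarrow> 'v set \<Rightarrow> nat \<Rightarrow> 'v set" where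
  "nbhd V E Y L = {v \<in> V. \<exists>y \<in> Y. \<exists>k \<le> L. (y, v) \<in> E ^^ k}"

definition graph_ball :: "'v set \<Rightarrow> 'v rel \<Rightarrow> 'v \<Rightarrow> nat \<Rightarrow> 'v set" where
  "graph_ball V E v r = nbhd V E {v} r"

text \<open>The connected components, as vertex sets, of the subgraph induced on \<open>W\<close>.\<close>

definition components_on :: "'v rel \<Rightarrow> 'v set \<Rightarrow> 'v set set" where
  "components_on E W = W // (E \<inter> W \<times> W)\<^sup>*"

definition bounded_in :: "'v set \<Rightarrow> 'v rel \<Rightarrow> 'v set \<Rightarrow> bool" where
  "bounded_in V E C \<longleftrightarrow> (\<exists>v \<in> V. \<exists>r. C \<subseteq> graph_ball V E v r)"

definition ecard :: "'a set \<Rightarrow> enat" where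
  "ecard A = (if finite A then enat (card A) else \<infinity>)"

definition ends :: "'v set \<Rightarrow> 'v rel \<Rightarrow> enat" where
  "ends V E = (SUP (v, r) \<in> V \<times> UNIV.
     ecard {C \<in> components_on E (V - graph_ball V E v r). \<not> bounded_in V E C})"

definition deep_components :: "'v set \<Rightarrow> 'v rel \<Rightarrow> 'v set \<Rightarrow> nat \<Rightarrow> 'v set set" where
  "deep_components V E Y L =
     {C \<in> components_on E (V - nbhd V E Y L). \<forall>r. \<exists>x \<in> C. x \<notin> nbhd V E Y r}"

text \<open>The ordinals up to \<open>\<omega> + 1\<close>.\<close>

datatype coend_number = Finite nat | Omega | Omega_Plus_One

instantiation coend_number :: linorder
begin

definition less_eq_coend_number :: "coend_number \<Rightarrow> coend_number \<Rightarrow> bool" where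
  "x \<le> y \<longleftrightarrow> (case x of
      Finite m \<Rightarrow> (case y of Finite n \<Rightarrow> m \<le> n | Omega \<Rightarrow> True | Omega_Plus_One \<Rightarrow> True)
    | Omega \<Rightarrow> y = Omega \<or> y = Omega_Plus_One
    | Omega_Plus_One \<Rightarrow> y = Omega_Plus_One)"

definition less_coend_number :: "coend_number \<Rightarrow> coend_number \<Rightarrow> bool" where
  "(x :: coend_number) < y \<longleftrightarrow> x \<le> y \<and> \<not> y \<le> x"

instance
  by standard
    (auto simp: less_eq_coend_number_def less_coend_number_def split: coend_number.splits)

end

definition coends :: "'v set \<Rightarrow> 'v rel \<Rightarrow> 'v set \<Rightarrow> coend_number" where
  "coends V E Y =
     (if \<exists>L. infinite (deep_components V E Y L) then Omega_Plus_One
      else if \<exists>n. \<forall>L. card (deep_components V E Y L) \<le> n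
        then Finite (Max (range (\<lambda>L. card (deep_components V E Y L))))
      else Omega)"

definition finite_generating_set :: "('a, 'b) monoid_scheme \<Rightarrow> 'a set \<Rightarrow> bool" where
  "finite_generating_set G S \<longleftrightarrow> finite S \<and> S \<subseteq> carrier G \<and> generate G S = carrier G"

definition cayley_edges :: "('a, 'b) monoid_scheme \<Rightarrow> 'a set \<Rightarrow> 'a rel" where
  "cayley_edges G S =
     (let D = {(g, g \<otimes>\<^bsub>G\<^esub> s) | g s. g \<in> carrier G \<and> s \<in> S} in D \<union> D\<inverse>)"

definition schreier_edges ::
    "('a, 'b) monoid_scheme \<Rightarrow> 'a set \<Rightarrow> 'a set \<Rightarrow> 'a set rel" where
  "schreier_edges G S H =
     (let D = {(H #>\<^bsub>G\<^esub> g, H #>\<^bsub>G\<^esub> (g \<otimes>\<^bsub>G\<^esub> s)) | g s. g \<in> carrier G \<and> s \<in> S} in D \<union> D\<inverse>)"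

text \<open>The number of ends of the Schreier graph, and the number of coends of \<open>H\<close> in the
  Cayley graph, with respect to the generating set \<open>S\<close>.\<close>

definition relative_ends :: "('a, 'b) monoid_scheme \<Rightarrow> 'a set \<Rightarrow> 'a set \<Rightarrow> enat" where
  "relative_ends G S H = ends (rcosets\<^bsub>G\<^esub> H) (schreier_edges G S H)"

definition relative_coends ::
    "('a, 'b) monoid_scheme \<Rightarrow> 'a set \<Rightarrow> 'a set \<Rightarrow> coend_number" where
  "relative_coends G S H = coends (carrier G) (cayley_edges G S) H"

definition finite_index_subgroup :: "'a set \<Rightarrow> ('a, 'b) monoid_scheme \<Rightarrow> bool" where
  "finite_index_subgroup K A \<longleftrightarrow> subgroup K A \<and> finite (rcosets\<^bsub>A\<^esub> K)"

definition codimension_one :: "('a, 'b) monoid_scheme \<Rightarrow> 'a set \<Rightarrow> 'a set \<Rightarrow> bool" where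
  "codimension_one G S H \<longleftrightarrow> subgroup H G \<and> relative_ends G S H \<ge> 2"

definition coarsely_separating :: "('a, 'b) monoid_scheme \<Rightarrow> 'a set \<Rightarrow> 'a set \<Rightarrow> bool" where
  "coarsely_separating G S H \<longleftrightarrow> subgroup H G \<and> relative_coends G S H \<ge> Finite 2"

definition virtually_codimension_one ::
    "('a, 'b) monoid_scheme \<Rightarrow> 'a set \<Rightarrow> 'a set \<Rightarrow> bool" where
  "virtually_codimension_one G S H \<longleftrightarrow>
     (\<exists>K. finite_index_subgroup K (G\<lparr>carrier := H\<rparr>) \<and> codimension_one G S K)"

definition separable_subgroup :: "'a set \<Rightarrow> ('a, 'b) monoid_scheme \<Rightarrow> bool" where
  "separable_subgroup K A \<longleftrightarrow> subgroup K A \<and>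
     (\<forall>a \<in> carrier A - K. \<exists>M. finite_index_subgroup M A \<and> K \<subseteq> M \<and> a \<notin> M)"

definition ERF :: "('a, 'b) monoid_scheme \<Rightarrow> bool" where
  "ERF A \<longleftrightarrow> group A \<and> (\<forall>K. subgroup K A \<longrightarrow> separable_subgroup K A)"

end

theory Submission
  imports Defs "HOL-Combinatorics.Permutations" "HOL-Library.Product_Plus"
    "HOL-Library.Countable_Set"
begin

text \<open>
  Call a set of group elements \<^emph>\<open>near\<close> a subgroup \<open>K\<close> if finitely many right cosets \<open>K f\<close> cover
  it. The neighbourhoods of \<open>K\<close> in the Cayley graph are exactly the unions of the cosets \<open>K w\<close> over
  short words \<open>w\<close>, so a set is near \<open>K\<close> precisely when it lies in some neighbourhood of \<open>K\<close>, and a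
  set of vertices of the Schreier graph is bounded precisely when its preimage is near \<open>K\<close>. A
  \<^emph>\<open>cut\<close> for \<open>K\<close> is a set \<open>P\<close> of group elements whose boundary is near \<open>K\<close>, although neither \<open>P\<close> nor
  its complement is near \<open>K\<close>. Two facts translate the geometry into this language:
  a subgroup with a cut is coarsely separating (\<open>cut_imp_coarsely_separating\<close>), and a subgroup has
  codimension one if and only if it has a cut that is invariant under left multiplication by
  the subgroup (\<open>codimension_one_iff_invariant_cut\<close>). Codimension one therefore implies coarse
  separation, and since nearness to \<open>H\<close> and to a finite-index subgroup of \<open>H\<close> coincide, virtual
  codimension one does so as well.

  In the other direction, let \<open>D\<close> be a deep component of the complement of a neighbourhood of \<open>H\<close>.
  The group \<open>H\<close> permutes these components. If \<open>M\<close> lies between the stabilizer of \<open>D\<close> in \<open>H\<close>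
  and \<open>H\<close>, then the union of the \<open>M\<close>-translates of \<open>D\<close> is \<open>M\<close>-invariant, and inside this union
  nearness to \<open>H\<close> is the same as nearness to \<open>M\<close>; so it is an invariant cut for \<open>M\<close> as soon as some
  deep component is not one of the translates (\<open>orbit_of_deep_component_cut\<close>). Taking for \<open>M\<close> the
  stabilizer itself, any second deep component shows that the stabilizer has codimension one. The
  stabilizer has finite index in \<open>H\<close> if there are only finitely many deep components. If \<open>H\<close> is ERF
  and the stabilizer is a proper subgroup, then a finite-index subgroup \<open>M\<close> of \<open>H\<close> contains it while
  missing some \<open>h\<close>, and \<open>h D\<close> is the deep component outside the \<open>M\<close>-orbit.

  For the last assertion, let \<open>A\<close> be the group of bijections of \<open>\<int>\<^sup>2\<close> that agree with a translation
  off a finite set, and let \<open>B\<close> be the subgroup of finitary permutations. Two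
  translations and two transpositions generate \<open>A\<close>, and \<open>B\<close> is the kernel of the homomorphism to
  \<open>\<int>\<^sup>2\<close> that sends \<open>g\<close> to its displacement \<open>q\<close>. Right multiplication by a
  generator changes \<open>g (- q)\<close> only if \<open>q\<close> is close to the origin, so the condition \<open>g (- q) = 0\<close>
  defines a cut for \<open>B\<close>. A pigeonhole argument on cosets shows that every finite-index subgroup \<open>K\<close> of
  \<open>B\<close> contains all products of two transpositions; hence at
  most two cosets of \<open>K\<close> have a given displacement, and if there are two, then right multiplication by
  a transposition among the generators exchanges them. As \<open>\<int>\<^sup>2\<close> has one end, \<open>K\<close> has no invariant cut.
\<close>

section \<open>Connected components and graph automorphisms\<close>

lemma nbhd_mono: "r \<le> r' \<Longrightarrow> nbhd V E Y r \<subseteq> nbhd V E Y r'"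
  unfolding nbhd_def using le_trans by blast

definition comp_at :: "'v rel \<Rightarrow> 'v set \<Rightarrow> 'v \<Rightarrow> 'v set" where
  "comp_at E W x = (E \<inter> W \<times> W)\<^sup>* `` {x}"

lemma components_on_eq: "components_on E W = comp_at E W ` W"
  unfolding components_on_def comp_at_def quotient_def by auto

lemma comp_at_self: "x \<in> comp_at E W x"
  unfolding comp_at_def by auto

lemma comp_at_step: "u \<in> comp_at E W x \<Longrightarrow> (u, v) \<in> E \<Longrightarrow> u \<in> W \<Longrightarrow> v \<in> W \<Longrightarrow> v \<in> comp_at E W x"
  unfolding comp_at_def by (auto intro: rtrancl_into_rtrancl)

lemma comp_at_induct [consumes 1, case_names base step]:
  assumes "u \<in> comp_at E W x" and "Q x"
    and "\<And>u v. u \<in> comp_at E W x \<Longrightarrow> Q u \<Longrightarrow> (u, v) \<in> E \<Longrightarrow> u \<in> W \<Longrightarrow> v \<in> W \<Longrightarrow> Q v"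
  shows "Q u"
proof -
  have "(x, u) \<in> (E \<inter> W \<times> W)\<^sup>*" using assms(1) unfolding comp_at_def by auto
  then show ?thesis
    by (induction rule: rtrancl_induct) (use assms(2,3) in \<open>auto simp: comp_at_def\<close>)
qed

lemma comp_at_subset: "x \<in> W \<Longrightarrow> comp_at E W x \<subseteq> W"
  by (rule subsetI, erule comp_at_induct) auto

lemma components_on_subset: "C \<in> components_on E W \<Longrightarrow> C \<subseteq> W"
  unfolding components_on_eq using comp_at_subset[of _ W E] by auto

lemma comp_at_eq:
  assumes "sym E" and "y \<in> comp_at E W x"
  shows "comp_at E W y = comp_at E W x"
proof -
  have "sym ((E \<inter> W \<times> W)\<^sup>*)"
    by (rule sym_rtrancl) (use assms(1) in \<open>auto simp: sym_def\<close>)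
  then show ?thesis using assms(2) unfolding comp_at_def
    by (auto dest: symD intro: rtrancl_trans)
qed

lemma components_on_disjoint:
  assumes "sym E" "C \<in> components_on E W" "C' \<in> components_on E W" "C \<noteq> C'"
  shows "C \<inter> C' = {}"
proof (rule ccontr)
  assume "C \<inter> C' \<noteq> {}"
  then obtain u where u: "u \<in> C" "u \<in> C'" by auto
  obtain x x' where "C = comp_at E W x" "C' = comp_at E W x'"
    using assms(2,3) unfolding components_on_eq by auto
  then have "C = comp_at E W u" "C' = comp_at E W u"
    using u comp_at_eq[OF assms(1), of u W x] comp_at_eq[OF assms(1), of u W x'] by simp_all
  with assms(4) show False by simp
qed

lemma components_on_step:
  assumes "C \<in> components_on E W" "u \<in> C" "(u, v) \<in> E" "v \<in> W"
  shows "v \<in> C"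
proof -
  obtain x where "x \<in> W" "C = comp_at E W x" using assms(1) unfolding components_on_eq by auto
  then show ?thesis using comp_at_step[of u E W x v] comp_at_subset[of x W E] assms by auto
qed

text \<open>An automorphism of the graph that preserves \<open>Y\<close>, given together with its inverse so that every
  statement about \<open>\<alpha>\<close> also applies to \<open>\<beta>\<close>.\<close>

definition graph_iso_pair :: "'v set \<Rightarrow> 'v rel \<Rightarrow> 'v set \<Rightarrow> ('v \<Rightarrow> 'v) \<Rightarrow> ('v \<Rightarrow> 'v) \<Rightarrow> bool" where
  "graph_iso_pair V E Y \<alpha> \<beta> \<longleftrightarrow>
     (\<forall>v \<in> V. \<alpha> v \<in> V \<and> \<beta> v \<in> V \<and> \<alpha> (\<beta> v) = v \<and> \<beta> (\<alpha> v) = v) \<and>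
     (\<forall>(u, v) \<in> E. (\<alpha> u, \<alpha> v) \<in> E \<and> (\<beta> u, \<beta> v) \<in> E) \<and>
     (\<forall>y \<in> Y. \<alpha> y \<in> Y \<and> \<beta> y \<in> Y)"

lemma graph_iso_pair_sym: "graph_iso_pair V E Y \<alpha> \<beta> \<Longrightarrow> graph_iso_pair V E Y \<beta> \<alpha>"
  unfolding graph_iso_pair_def by auto

lemma graph_iso_pair_nbhd:
  assumes "graph_iso_pair V E Y \<alpha> \<beta>" and "v \<in> nbhd V E Y r"
  shows "\<alpha> v \<in> nbhd V E Y r"
proof -
  have "(u, v) \<in> E ^^ k \<Longrightarrow> (\<alpha> u, \<alpha> v) \<in> E ^^ k" for u v k
    by (induction k arbitrary: v)
      (use assms(1) in \<open>fastforce simp: graph_iso_pair_def relcomp_unfold\<close>)+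
  then show ?thesis using assms unfolding nbhd_def graph_iso_pair_def by blast
qed

lemma graph_iso_pair_nbhd_iff:
  assumes "graph_iso_pair V E Y \<alpha> \<beta>" and "v \<in> V"
  shows "\<alpha> v \<in> nbhd V E Y r \<longleftrightarrow> v \<in> nbhd V E Y r"
proof
  assume "\<alpha> v \<in> nbhd V E Y r"
  from graph_iso_pair_nbhd[OF graph_iso_pair_sym[OF assms(1)] this] assms
  show "v \<in> nbhd V E Y r" unfolding graph_iso_pair_def by auto
qed (rule graph_iso_pair_nbhd[OF assms(1)])

lemma graph_iso_pair_comp_at_subset:
  assumes iso: "graph_iso_pair V E Y \<alpha> \<beta>"
  shows "\<alpha> ` comp_at E (V - nbhd V E Y L) x \<subseteq> comp_at E (V - nbhd V E Y L) (\<alpha> x)"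
proof -
  have "\<alpha> u \<in> comp_at E (V - nbhd V E Y L) (\<alpha> x)" if "u \<in> comp_at E (V - nbhd V E Y L) x" for u
    using that
  proof (induction rule: comp_at_induct)
    case base
    show ?case by (rule comp_at_self)
  next
    case (step u v)
    show ?case
    proof (rule comp_at_step[OF step.IH])
      show "(\<alpha> u, \<alpha> v) \<in> E" using iso step unfolding graph_iso_pair_def by auto
      show "\<alpha> u \<in> V - nbhd V E Y L" "\<alpha> v \<in> V - nbhd V E Y L"
        using iso step graph_iso_pair_nbhd_iff[OF iso] unfolding graph_iso_pair_def by auto
    qed
  qed
  then show ?thesis by auto
qed

lemma graph_iso_pair_comp_at:
  assumes iso: "graph_iso_pair V E Y \<alpha> \<beta>" and x: "x \<in> V - nbhd V E Y L"
  shows "\<alpha> ` comp_at E (V - nbhd V E Y L) x = comp_at E (V - nbhd V E Y L) (\<alpha> x)"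
proof
  let ?C = "comp_at E (V - nbhd V E Y L)"
  show "\<alpha> ` ?C x \<subseteq> ?C (\<alpha> x)" by (rule graph_iso_pair_comp_at_subset[OF iso])
  have ax: "\<alpha> x \<in> V - nbhd V E Y L" "\<beta> (\<alpha> x) = x"
    using iso x graph_iso_pair_nbhd_iff[OF iso] unfolding graph_iso_pair_def by auto
  have "\<beta> ` ?C (\<alpha> x) \<subseteq> ?C x"
    using graph_iso_pair_comp_at_subset[OF graph_iso_pair_sym[OF iso], of L "\<alpha> x"] ax by simp
  moreover have "?C (\<alpha> x) \<subseteq> V" using comp_at_subset[OF ax(1), of E] by auto
  then have "\<alpha> (\<beta> u) = u" if "u \<in> ?C (\<alpha> x)" for u
    using iso that unfolding graph_iso_pair_def by auto
  ultimately show "?C (\<alpha> x) \<subseteq> \<alpha> ` ?C x" by (force simp: image_iff subset_iff)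
qed

lemma graph_iso_pair_deep_components:
  assumes iso: "graph_iso_pair V E Y \<alpha> \<beta>" and D: "D \<in> deep_components V E Y L"
  shows "\<alpha> ` D \<in> deep_components V E Y L"
proof -
  from D obtain x where x: "x \<in> V - nbhd V E Y L" "D = comp_at E (V - nbhd V E Y L) x"
    and deep: "\<And>r. \<exists>x\<in>D. x \<notin> nbhd V E Y r"
    unfolding deep_components_def components_on_eq by auto
  have "\<alpha> ` D \<in> components_on E (V - nbhd V E Y L)"
    using graph_iso_pair_comp_at[OF iso x(1)] x iso graph_iso_pair_nbhd_iff[OF iso]
    unfolding components_on_eq graph_iso_pair_def by auto
  moreover have "D \<subseteq> V" using x comp_at_subset[OF x(1), of E] by auto
  then have "\<exists>x\<in>\<alpha> ` D. x \<notin> nbhd V E Y r" for r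
    using deep[of r] graph_iso_pair_nbhd_iff[OF iso] by auto
  ultimately show ?thesis unfolding deep_components_def by auto
qed

text \<open>On a path from \<open>Y\<close> to \<open>x\<close>, the part after the last vertex at distance at most \<open>L\<close> from \<open>Y\<close> stays in
  one component, and it starts at distance \<open>L + 1\<close>.\<close>

lemma comp_at_meets_frontier:
  assumes "sym E" "E \<subseteq> V \<times> V" "x \<in> nbhd V E Y r" "x \<notin> nbhd V E Y L"
  shows "\<exists>y \<in> nbhd V E Y (Suc L) - nbhd V E Y L. x \<in> comp_at E (V - nbhd V E Y L) y"
proof -
  from assms(3) obtain y0 k where "y0 \<in> Y" "(y0, x) \<in> E ^^ k" "x \<in> V"
    unfolding nbhd_def by auto
  from this(2,3) assms(4) show ?thesis
  proof (induction k arbitrary: x)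
    case 0
    then have "x \<in> nbhd V E Y L" using \<open>y0 \<in> Y\<close>
      unfolding nbhd_def by (auto intro!: bexI[of _ y0] exI[of _ 0])
    with 0 show ?case by simp
  next
    case (Suc k)
    then obtain z where z: "(y0, z) \<in> E ^^ k" "(z, x) \<in> E" by auto
    then have V: "z \<in> V" "x \<in> V" using assms(2) by auto
    show ?case
    proof (cases "z \<in> nbhd V E Y L")
      case True
      then obtain y j where "y \<in> Y" "j \<le> L" "(y, z) \<in> E ^^ j" unfolding nbhd_def by auto
      then have "x \<in> nbhd V E Y (Suc L)"
        using z V relpow_Suc_I[of y z j E x] unfolding nbhd_def by (auto intro!: exI[of _ "Suc j"] bexI[of _ y])
      then show ?thesis using Suc.prems comp_at_self by fastforce
    next
      case False
      from Suc.IH[OF z(1) V(1) False] obtain y where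
        y: "y \<in> nbhd V E Y (Suc L) - nbhd V E Y L" "z \<in> comp_at E (V - nbhd V E Y L) y" by auto
      have "x \<in> comp_at E (V - nbhd V E Y L) y"
        by (rule comp_at_step[OF y(2) z(2)]) (use False Suc.prems V in auto)
      with y show ?thesis by auto
    qed
  qed
qed

section \<open>Counting deep components and ends\<close>

text \<open>The complement of the \<open>L\<close>-neighbourhood inside \<open>P\<close> is a union of components. If all of them were
  shallow, their depths might still be unbounded; what rules this out is symmetry: each of these components
  contains a vertex at distance \<open>L + 1\<close>, up to automorphisms there are only finitely
  many such vertices, and automorphisms preserve depth. So \<open>P\<close> would have finite depth.\<close>

lemma deep_component_subset:
  assumes E: "sym E" "E \<subseteq> V \<times> V"
    and conn: "\<And>v. v \<in> V \<Longrightarrow> \<exists>r. v \<in> nbhd V E Y r"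
    and P: "P \<subseteq> V" "\<And>r. \<not> P \<subseteq> nbhd V E Y r"
    and cob: "\<And>u v. (u, v) \<in> E \<Longrightarrow> u \<in> P \<Longrightarrow> v \<notin> P \<Longrightarrow> u \<in> nbhd V E Y L"
    and W: "finite W" "\<And>y. y \<in> nbhd V E Y (Suc L) \<Longrightarrow> \<exists>\<alpha> \<beta>. graph_iso_pair V E Y \<alpha> \<beta> \<and> \<alpha> y \<in> W"
  shows "\<exists>D \<in> deep_components V E Y L. D \<subseteq> P"
proof (rule ccontr)
  assume no_deep: "\<not> ?thesis"
  let ?N = "nbhd V E Y"
  let ?C = "comp_at E (V - ?N L)"
  have subP: "?C x \<subseteq> P" if "x \<in> P" for x
  proof
    fix u assume "u \<in> ?C x"
    then show "u \<in> P" by (induction rule: comp_at_induct) (use that cob in auto)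
  qed
  define shallow where "shallow w r \<longleftrightarrow> ?C w \<subseteq> ?N r" for w r
  \<comment> \<open>A depth bound for the component of \<open>w\<close>, if it has one: chosen for \<open>w\<close> alone, it bounds the
    depth of every component that an automorphism takes to it.\<close>
  define \<rho> where "\<rho> w = (SOME r. shallow w r)" for w
  have "x \<in> ?N (max L (Max (\<rho> ` W)))" if x: "x \<in> P" for x
  proof (cases "x \<in> ?N L")
    case True
    then show ?thesis using nbhd_mono[of L "max L (Max (\<rho> ` W))" V E Y] by auto
  next
    case False
    have "x \<in> V" using x P by auto
    then obtain r where "x \<in> ?N r" using conn by auto
    from comp_at_meets_frontier[OF E this False]
    obtain y where y: "y \<in> ?N (Suc L)" "y \<notin> ?N L" "x \<in> ?C y" by auto
    have yV: "y \<in> V - ?N L" using y unfolding nbhd_def by auto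
    have yP: "?C y \<subseteq> P" using subP[OF x] comp_at_eq[OF E(1) y(3)] by simp
    obtain \<alpha> \<beta> where iso: "graph_iso_pair V E Y \<alpha> \<beta>" and w: "\<alpha> y \<in> W" using W(2)[OF y(1)] by auto
    have "?C y \<notin> deep_components V E Y L" using no_deep yP by auto
    then obtain r where r: "?C y \<subseteq> ?N r"
      using yV unfolding deep_components_def components_on_eq by auto
    have "shallow (\<alpha> y) r" unfolding shallow_def graph_iso_pair_comp_at[OF iso yV, symmetric]
      using r graph_iso_pair_nbhd[OF iso] by auto
    then have "shallow (\<alpha> y) (\<rho> (\<alpha> y))" unfolding \<rho>_def by (rule someI)
    moreover have "\<alpha> x \<in> ?C (\<alpha> y)" using graph_iso_pair_comp_at[OF iso yV] y(3) by auto
    ultimately have "\<alpha> x \<in> ?N (\<rho> (\<alpha> y))" unfolding shallow_def by auto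
    then have "x \<in> ?N (\<rho> (\<alpha> y))" using graph_iso_pair_nbhd_iff[OF iso \<open>x \<in> V\<close>] by auto
    moreover have "\<rho> (\<alpha> y) \<le> max L (Max (\<rho> ` W))" using W(1) w by (auto intro: max.coboundedI2)
    ultimately show ?thesis using nbhd_mono by fastforce
  qed
  then show False using P(2) by blast
qed

lemma two_elements_iff: "(\<exists>x \<in> A. \<exists>y \<in> A. x \<noteq> y) \<longleftrightarrow> infinite A \<or> 2 \<le> card A"
proof (cases "finite A")
  case True
  have "(\<forall>x \<in> A. \<forall>y \<in> A. x = y) \<longleftrightarrow> card A \<le> Suc 0" using card_le_Suc0_iff_eq[OF True] by simp
  then show ?thesis using True by (auto simp: not_less_eq_eq[symmetric] numeral_2_eq_2)
next
  case False
  have "\<exists>x \<in> A. \<exists>y \<in> A. x \<noteq> y"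
  proof (rule ccontr)
    assume "\<not> ?thesis"
    then have "A \<subseteq> {x}" if "x \<in> A" for x using that by auto
    then have "finite A" by (metis ex_in_conv finite.emptyI finite.insertI finite_subset)
    with False show False by simp
  qed
  then show ?thesis using False by simp
qed

lemma coends_ge_2_iff:
  "Finite 2 \<le> coends V E Y \<longleftrightarrow>
     (\<exists>L. \<exists>D \<in> deep_components V E Y L. \<exists>D' \<in> deep_components V E Y L. D \<noteq> D')"
proof -
  let ?d = "deep_components V E Y"
  note two = two_elements_iff
  show ?thesis
  proof (cases "\<exists>L. infinite (?d L)")
    case True
    then show ?thesis unfolding two by (auto simp: coends_def less_eq_coend_number_def)
  next
    case fin: False
    show ?thesis
    proof (cases "\<exists>n. \<forall>L. card (?d L) \<le> n")
      case True
      then have "finite (range (\<lambda>L. card (?d L)))"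
        using finite_nat_set_iff_bounded_le by auto
      then have "2 \<le> Max (range (\<lambda>L. card (?d L))) \<longleftrightarrow> (\<exists>L. 2 \<le> card (?d L))"
        by (subst Max_ge_iff) auto
      then show ?thesis unfolding two using fin True
        by (auto simp: coends_def less_eq_coend_number_def)
    next
      case False
      then obtain L where "\<not> card (?d L) \<le> 1" by auto
      then have "2 \<le> card (?d L)" by auto
      then show ?thesis unfolding two using fin False
        by (auto simp: coends_def less_eq_coend_number_def)
    qed
  qed
qed

lemma coends_le_Omega: "coends V E Y \<le> Omega \<Longrightarrow> finite (deep_components V E Y L)"
  unfolding coends_def less_eq_coend_number_def by (auto split: if_splits)

lemma ecard_ge_2_iff: "2 \<le> ecard A \<longleftrightarrow> (\<exists>x \<in> A. \<exists>y \<in> A. x \<noteq> y)"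
  unfolding two_elements_iff ecard_def by (simp add: numeral_eq_enat)

lemma ends_ge_2_iff:
  "2 \<le> ends V E \<longleftrightarrow> (\<exists>v \<in> V. \<exists>r.
     \<exists>C \<in> components_on E (V - graph_ball V E v r). \<exists>C' \<in> components_on E (V - graph_ball V E v r).
       C \<noteq> C' \<and> \<not> bounded_in V E C \<and> \<not> bounded_in V E C')"
proof -
  let ?f = "\<lambda>(v, r). ecard {C \<in> components_on E (V - graph_ball V E v r). \<not> bounded_in V E C}"
  have enat: "2 \<le> n \<longleftrightarrow> 1 < n" for n :: enat
    by (cases n) (auto simp: one_enat_def numeral_eq_enat)
  have "2 \<le> ends V E \<longleftrightarrow> (\<exists>p \<in> V \<times> UNIV. 2 \<le> ?f p)"
    unfolding enat ends_def less_SUP_iff ..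
  then show ?thesis by (fastforce simp: ecard_ge_2_iff)
qed

section \<open>Word balls in Cayley and Schreier graphs\<close>

locale fin_gen_group = group G for G (structure) +
  fixes S
  assumes fgs: "finite_generating_set G S"
begin

definition gens :: "'a set" where
  "gens = S \<union> m_inv G ` S"

primrec words :: "nat \<Rightarrow> 'a set" where
  "words 0 = {\<one>}"
| "words (Suc k) = {w \<otimes> s | w s. w \<in> words k \<and> s \<in> gens}"

lemma S_closed: "S \<subseteq> carrier G"
  using fgs unfolding finite_generating_set_def by auto

lemma gens_closed: "s \<in> gens \<Longrightarrow> s \<in> carrier G"
  using S_closed unfolding gens_def by auto

lemma gens_inv: "s \<in> gens \<Longrightarrow> inv s \<in> gens"
  using S_closed unfolding gens_def by auto

lemma finite_gens: "finite gens"
  using fgs unfolding gens_def finite_generating_set_def by auto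

lemma words_closed: "w \<in> words k \<Longrightarrow> w \<in> carrier G"
  by (induction k arbitrary: w) (auto simp: gens_closed)

lemma finite_words: "finite (words k)"
proof (induction k)
  case (Suc k)
  have "words (Suc k) = (\<lambda>(w, s). w \<otimes> s) ` (words k \<times> gens)" by auto
  then show ?case using Suc finite_gens by simp
qed simp

lemma words_mult: "v \<in> words j \<Longrightarrow> w \<in> words k \<Longrightarrow> v \<otimes> w \<in> words (j + k)"
proof (induction k arbitrary: w)
  case 0
  then show ?case by (simp add: words_closed)
next
  case (Suc k)
  then obtain u s where u: "w = u \<otimes> s" "u \<in> words k" "s \<in> gens" by auto
  then have "v \<otimes> w = (v \<otimes> u) \<otimes> s"
    using Suc.prems by (simp add: m_assoc words_closed gens_closed)
  moreover have "v \<otimes> u \<in> words (j + k)" using Suc u by auto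
  ultimately show ?case using u by auto
qed

lemma words_cover:
  assumes "g \<in> carrier G"
  shows "\<exists>k. g \<in> words k"
proof -
  have gen: "\<exists>k. s \<in> words k" if "s \<in> gens" for s
  proof
    show "s \<in> words (Suc 0)" using that gens_closed[OF that] by force
  qed
  have "g \<in> generate G S" using assms fgs unfolding finite_generating_set_def by simp
  then show ?thesis
  proof induction
    case one
    have "\<one> \<in> words 0" by simp
    then show ?case by blast
  next
    case (incl h)
    then show ?case using gen unfolding gens_def by auto
  next
    case (inv h)
    then show ?case using gen unfolding gens_def by auto
  next
    case (eng h1 h2)
    then show ?case using words_mult by blast
  qed
qed

lemma cayley_edges_iff:
  "(x, y) \<in> cayley_edges G S \<longleftrightarrow> x \<in> carrier G \<and> (\<exists>s \<in> gens. y = x \<otimes> s)"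
proof
  assume "(x, y) \<in> cayley_edges G S"
  then consider g s where "x = g" "y = g \<otimes> s" "g \<in> carrier G" "s \<in> S"
    | g s where "y = g" "x = g \<otimes> s" "g \<in> carrier G" "s \<in> S"
    unfolding cayley_edges_def Let_def by auto
  then show "x \<in> carrier G \<and> (\<exists>s \<in> gens. y = x \<otimes> s)"
  proof cases
    case 1
    then show ?thesis unfolding gens_def by auto
  next
    case 2
    then have "y = x \<otimes> inv s" using S_closed by (auto simp: m_assoc subset_iff)
    then show ?thesis using 2 S_closed unfolding gens_def by auto
  qed
next
  assume "x \<in> carrier G \<and> (\<exists>s \<in> gens. y = x \<otimes> s)"
  then obtain s where x: "x \<in> carrier G" and s: "s \<in> gens" "y = x \<otimes> s" by auto
  show "(x, y) \<in> cayley_edges G S"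
  proof (cases "s \<in> S")
    case True
    then show ?thesis using x s unfolding cayley_edges_def Let_def by auto
  next
    case False
    then obtain t where t: "t \<in> S" "s = inv t" using s unfolding gens_def by auto
    then have "x = y \<otimes> t" "y \<in> carrier G" using s x S_closed by (auto simp: m_assoc subset_iff)
    then show ?thesis using t unfolding cayley_edges_def Let_def by auto
  qed
qed

lemma rcos_mult_cong:
  assumes "subgroup K G" "K #> g = K #> g'" "g \<in> carrier G" "g' \<in> carrier G" "a \<in> carrier G"
  shows "K #> (g \<otimes> a) = K #> (g' \<otimes> a)"
  using assms coset_mult_assoc[OF subgroup.subset[OF assms(1)]] by metis

lemma schreier_edges_iff:
  assumes K: "subgroup K G"
  shows "(U, Y) \<in> schreier_edges G S K \<longleftrightarrow>
    (\<exists>g \<in> carrier G. \<exists>s \<in> gens. U = K #> g \<and> Y = K #> (g \<otimes> s))"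
proof -
  have "(U, Y) \<in> schreier_edges G S K \<longleftrightarrow>
      (\<exists>x y. (x, y) \<in> cayley_edges G S \<and> U = K #> x \<and> Y = K #> y)"
    unfolding schreier_edges_def cayley_edges_def Let_def Un_iff converse_iff mem_Collect_eq
      prod.inject by blast
  then show ?thesis unfolding cayley_edges_iff by blast
qed

lemma cayley_sym: "sym (cayley_edges G S)"
  unfolding cayley_edges_def Let_def by (auto simp: sym_def)

lemma schreier_sym: "sym (schreier_edges G S K)"
  unfolding schreier_edges_def Let_def by (auto simp: sym_def)

lemma cayley_subset: "cayley_edges G S \<subseteq> carrier G \<times> carrier G"
  by (auto simp: cayley_edges_iff gens_closed)

lemma schreier_subset:
  assumes "subgroup K G"
  shows "schreier_edges G S K \<subseteq> (rcosets K) \<times> (rcosets K)"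
  using schreier_edges_iff[OF assms] gens_closed by (fastforce simp: RCOSETS_def)

lemma cayley_relpow:
  assumes "x \<in> carrier G"
  shows "(x, y) \<in> cayley_edges G S ^^ k \<longleftrightarrow> (\<exists>w \<in> words k. y = x \<otimes> w)"
proof (induction k arbitrary: y)
  case 0
  then show ?case using assms by auto
next
  case (Suc k)
  show ?case
  proof
    assume "(x, y) \<in> cayley_edges G S ^^ Suc k"
    then obtain z where "(x, z) \<in> cayley_edges G S ^^ k" "(z, y) \<in> cayley_edges G S" by auto
    with Suc obtain w s where "w \<in> words k" "z = x \<otimes> w" "s \<in> gens" "y = z \<otimes> s"
      by (auto simp: cayley_edges_iff)
    then show "\<exists>w \<in> words (Suc k). y = x \<otimes> w" using assms
      by (auto simp: m_assoc words_closed gens_closed intro!: bexI[of _ "w \<otimes> s"])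
  next
    assume "\<exists>w \<in> words (Suc k). y = x \<otimes> w"
    then obtain w s where w: "w \<in> words k" "s \<in> gens" "y = x \<otimes> (w \<otimes> s)" by auto
    then have "(x, x \<otimes> w) \<in> cayley_edges G S ^^ k" "(x \<otimes> w, y) \<in> cayley_edges G S"
      using Suc assms by (auto simp: cayley_edges_iff m_assoc words_closed gens_closed)
    then show "(x, y) \<in> cayley_edges G S ^^ Suc k" by auto
  qed
qed

lemma schreier_relpow:
  assumes K: "subgroup K G" and "g \<in> carrier G"
  shows "(K #> g, Y) \<in> schreier_edges G S K ^^ k \<longleftrightarrow> (\<exists>w \<in> words k. Y = K #> (g \<otimes> w))"
proof (induction k arbitrary: Y)
  case 0
  then show ?case using assms by auto
next
  case (Suc k)
  let ?E = "schreier_edges G S K"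
  show ?case
  proof
    assume "(K #> g, Y) \<in> ?E ^^ Suc k"
    then obtain Z where "(K #> g, Z) \<in> ?E ^^ k" "(Z, Y) \<in> ?E" by auto
    with Suc obtain w g' s where w: "w \<in> words k" "Z = K #> (g \<otimes> w)" "g' \<in> carrier G" "s \<in> gens"
      "Z = K #> g'" "Y = K #> (g' \<otimes> s)"
      using schreier_edges_iff[OF K] by auto
    then have "Y = K #> (g \<otimes> w \<otimes> s)"
      using rcos_mult_cong[OF K, of g' "g \<otimes> w" s] assms words_closed gens_closed by auto
    then show "\<exists>w \<in> words (Suc k). Y = K #> (g \<otimes> w)" using assms w
      by (auto simp: m_assoc words_closed gens_closed intro!: bexI[of _ "w \<otimes> s"])
  next
    assume "\<exists>w \<in> words (Suc k). Y = K #> (g \<otimes> w)"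
    then obtain w s where w: "w \<in> words k" "s \<in> gens" "Y = K #> (g \<otimes> (w \<otimes> s))" by auto
    then have "(K #> g, K #> (g \<otimes> w)) \<in> ?E ^^ k" "(K #> (g \<otimes> w), Y) \<in> ?E"
    proof -
      show "(K #> g, K #> (g \<otimes> w)) \<in> ?E ^^ k" using Suc w by auto
      have "g \<otimes> w \<in> carrier G" "Y = K #> (g \<otimes> w \<otimes> s)"
        using w assms by (auto simp: m_assoc words_closed gens_closed)
      then show "(K #> (g \<otimes> w), Y) \<in> ?E" using w(2) unfolding schreier_edges_iff[OF K] by blast
    qed
    then show "(K #> g, Y) \<in> ?E ^^ Suc k" by auto
  qed
qed

definition ball_one :: "nat \<Rightarrow> 'a set" where
  "ball_one r = (\<Union>k \<le> r. words k)"

lemma finite_ball_one: "finite (ball_one r)"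
  unfolding ball_one_def using finite_words by auto

lemma ball_one_closed: "w \<in> ball_one r \<Longrightarrow> w \<in> carrier G"
  unfolding ball_one_def using words_closed by auto

lemma ball_one_cover_finite:
  assumes "finite F" "F \<subseteq> carrier G"
  shows "\<exists>r. F \<subseteq> ball_one r"
  using assms
proof (induction F)
  case (insert g F)
  then obtain r k where "F \<subseteq> ball_one r" "g \<in> words k" using words_cover[of g] by auto
  then have "insert g F \<subseteq> ball_one (max r k)" unfolding ball_one_def by fastforce
  then show ?case by blast
qed simp

abbreviation cayley_nbhd :: "'a set \<Rightarrow> nat \<Rightarrow> 'a set" where
  "cayley_nbhd K r \<equiv> nbhd (carrier G) (cayley_edges G S) K r"

abbreviation schreier_nbhd :: "'a set \<Rightarrow> nat \<Rightarrow> 'a set set" where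
  "schreier_nbhd K r \<equiv> nbhd (rcosets K) (schreier_edges G S K) {K} r"

lemma cayley_nbhd_eq:
  assumes K: "subgroup K G"
  shows "cayley_nbhd K r = (\<Union>w \<in> ball_one r. K #> w)"
proof -
  have KG: "k \<in> carrier G" if "k \<in> K" for k using subgroup.mem_carrier[OF K that] .
  have "g \<in> cayley_nbhd K r \<longleftrightarrow> (\<exists>y \<in> K. \<exists>k \<le> r. \<exists>w \<in> words k. g = y \<otimes> w)" for g
    unfolding nbhd_def using KG words_closed by (auto simp: cayley_relpow)
  then show ?thesis unfolding ball_one_def r_coset_def by blast
qed

lemma schreier_ball_eq:
  assumes K: "subgroup K G" and g: "g \<in> carrier G"
  shows "graph_ball (rcosets K) (schreier_edges G S K) (K #> g) r = (\<lambda>w. K #> (g \<otimes> w)) ` ball_one r"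
proof -
  have "U \<in> graph_ball (rcosets K) (schreier_edges G S K) (K #> g) r \<longleftrightarrow>
      (\<exists>k \<le> r. \<exists>w \<in> words k. U = K #> (g \<otimes> w))" for U
    unfolding graph_ball_def nbhd_def RCOSETS_def
    using g words_closed by (auto simp: schreier_relpow[OF K])
  then show ?thesis unfolding ball_one_def by blast
qed

lemma schreier_nbhd_eq:
  assumes K: "subgroup K G"
  shows "schreier_nbhd K r = (\<lambda>w. K #> w) ` ball_one r"
  using schreier_ball_eq[OF K one_closed, of r] ball_one_closed K
  by (simp add: graph_ball_def coset_mult_one subgroup.subset)

lemma rcos_in_schreier_nbhd_iff:
  assumes K: "subgroup K G" and g: "g \<in> carrier G"
  shows "K #> g \<in> schreier_nbhd K r \<longleftrightarrow> g \<in> cayley_nbhd K r"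
proof
  assume "K #> g \<in> schreier_nbhd K r"
  then show "g \<in> cayley_nbhd K r"
    using rcos_self[OF g K] by (auto simp: schreier_nbhd_eq[OF K] cayley_nbhd_eq[OF K])
next
  assume "g \<in> cayley_nbhd K r"
  then show "K #> g \<in> schreier_nbhd K r" using ball_one_closed repr_independence[OF _ _ K]
    by (auto simp: schreier_nbhd_eq[OF K] cayley_nbhd_eq[OF K])
qed

section \<open>Cuts\<close>

definition near :: "'a set \<Rightarrow> 'a set \<Rightarrow> bool" where
  "near K U \<longleftrightarrow> (\<exists>F. finite F \<and> F \<subseteq> carrier G \<and> U \<subseteq> (\<Union>f \<in> F. K #> f))"

lemma near_iff_nbhd:
  assumes K: "subgroup K G"
  shows "near K U \<longleftrightarrow> (\<exists>r. U \<subseteq> cayley_nbhd K r)"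
proof
  assume "near K U"
  then obtain F where F: "finite F" "F \<subseteq> carrier G" "U \<subseteq> (\<Union>f \<in> F. K #> f)" unfolding near_def by auto
  then obtain r where "F \<subseteq> ball_one r" using ball_one_cover_finite by blast
  then have "U \<subseteq> cayley_nbhd K r" using F unfolding cayley_nbhd_eq[OF K] by blast
  then show "\<exists>r. U \<subseteq> cayley_nbhd K r" ..
next
  assume "\<exists>r. U \<subseteq> cayley_nbhd K r"
  then show "near K U" unfolding near_def cayley_nbhd_eq[OF K]
    using finite_ball_one ball_one_closed by blast
qed

lemma near_mono: "near K Y \<Longrightarrow> U \<subseteq> Y \<Longrightarrow> near K U"
  unfolding near_def by blast

lemma near_Un:
  assumes "near K U" "near K Y" shows "near K (U \<union> Y)"
proof -
  obtain F F' where "finite F" "F \<subseteq> carrier G" "U \<subseteq> (\<Union>f \<in> F. K #> f)"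
    "finite F'" "F' \<subseteq> carrier G" "Y \<subseteq> (\<Union>f \<in> F'. K #> f)"
    using assms unfolding near_def by auto
  then show ?thesis unfolding near_def by (intro exI[of _ "F \<union> F'"]) auto
qed

lemma near_UN: "finite I \<Longrightarrow> (\<And>i. i \<in> I \<Longrightarrow> near K (U i)) \<Longrightarrow> near K (\<Union>i \<in> I. U i)"
proof (induction I rule: finite_induct)
  case empty
  then show ?case unfolding near_def by (auto intro!: exI[of _ "{}"])
qed (auto intro: near_Un)

lemma near_translate:
  assumes K: "K \<subseteq> carrier G" and U: "near K U" and a: "a \<in> carrier G"
  shows "near K ((\<lambda>x. x \<otimes> a) ` U)"
proof -
  obtain F where F: "finite F" "F \<subseteq> carrier G" "U \<subseteq> (\<Union>f \<in> F. K #> f)"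
    using U unfolding near_def by auto
  have "(\<lambda>x. x \<otimes> a) ` U \<subseteq> (\<Union>f \<in> (\<lambda>f. f \<otimes> a) ` F. K #> f)"
  proof
    fix y assume "y \<in> (\<lambda>x. x \<otimes> a) ` U"
    then obtain f k where f: "f \<in> F" "k \<in> K" "y = k \<otimes> f \<otimes> a" using F unfolding r_coset_def by blast
    then have "y = k \<otimes> (f \<otimes> a)" using K F a by (auto simp: m_assoc subset_iff)
    with f(1,2) show "y \<in> (\<Union>f \<in> (\<lambda>f. f \<otimes> a) ` F. K #> f)" unfolding r_coset_def by blast
  qed
  then show ?thesis using F a unfolding near_def by (intro exI[of _ "(\<lambda>f. f \<otimes> a) ` F"]) auto
qed

text \<open>In the theory of ends, the invariant sets of this kind are the almost invariant sets that define the
  number of ends of a pair of groups.\<close>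

definition cut :: "'a set \<Rightarrow> 'a set \<Rightarrow> bool" where
  "cut K P \<longleftrightarrow> P \<subseteq> carrier G \<and>
     (\<forall>s \<in> S. near K {g \<in> carrier G. (g \<in> P) \<noteq> (g \<otimes> s \<in> P)}) \<and>
     \<not> near K P \<and> \<not> near K (carrier G - P)"

lemma cut_complement:
  assumes "cut K P"
  shows "cut K (carrier G - P)"
proof -
  have "{g \<in> carrier G. (g \<in> carrier G - P) \<noteq> (g \<otimes> s \<in> carrier G - P)}
     = {g \<in> carrier G. (g \<in> P) \<noteq> (g \<otimes> s \<in> P)}" if "s \<in> S" for s
    using that S_closed by auto
  moreover have "carrier G - (carrier G - P) = P" using assms unfolding cut_def by auto
  ultimately show ?thesis using assms unfolding cut_def by simp
qed

lemma cut_boundary: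
  assumes K: "subgroup K G" and cut: "cut K P"
  shows "\<exists>L. \<forall>g \<in> carrier G. \<forall>s \<in> gens. (g \<in> P) \<noteq> (g \<otimes> s \<in> P) \<longrightarrow> g \<in> cayley_nbhd K L"
proof -
  let ?B = "\<lambda>s. {g \<in> carrier G. (g \<in> P) \<noteq> (g \<otimes> s \<in> P)}"
  have "near K (?B s)" if s: "s \<in> gens" for s
  proof (cases "s \<in> S")
    case True
    then show ?thesis using cut unfolding cut_def by auto
  next
    case False
    then obtain t where t: "t \<in> S" "s = inv t" using s unfolding gens_def by auto
    have "?B s \<subseteq> (\<lambda>x. x \<otimes> t) ` ?B t"
    proof
      fix g assume g: "g \<in> ?B s"
      have "g = (g \<otimes> s) \<otimes> t" using g t S_closed by (auto simp: m_assoc subset_iff)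
      moreover have "g \<otimes> s \<in> ?B t" using g t S_closed calculation gens_closed[OF s] by auto
      ultimately show "g \<in> (\<lambda>x. x \<otimes> t) ` ?B t" by blast
    qed
    moreover have "near K ((\<lambda>x. x \<otimes> t) ` ?B t)"
      using near_translate[OF subgroup.subset[OF K]] cut t S_closed unfolding cut_def by auto
    ultimately show ?thesis using near_mono by blast
  qed
  then have "near K (\<Union>s \<in> gens. ?B s)" by (intro near_UN finite_gens)
  then show ?thesis unfolding near_iff_nbhd[OF K] by blast
qed

lemma left_mult_graph_iso_pair:
  assumes H: "subgroup H G" and h: "h \<in> H"
  shows "graph_iso_pair (carrier G) (cayley_edges G S) H (\<lambda>g. h \<otimes> g) (\<lambda>g. inv h \<otimes> g)"
proof -
  have hG: "h \<in> carrier G" using subgroup.mem_carrier[OF H h] .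
  have "(a \<otimes> u, a \<otimes> v) \<in> cayley_edges G S" if "(u, v) \<in> cayley_edges G S" "a \<in> carrier G" for a u v
    using that by (auto simp: cayley_edges_iff m_assoc gens_closed)
  then show ?thesis
    using hG h H by (auto simp: graph_iso_pair_def m_assoc[symmetric]
        subgroup.m_closed subgroup.m_inv_closed)
qed

lemma mem_cayley_nbhd:
  assumes "subgroup K G" "g \<in> carrier G" shows "\<exists>r. g \<in> cayley_nbhd K r"
proof -
  have "near K {g}" unfolding near_def using assms rcos_self by (intro exI[of _ "{g}"]) auto
  then show ?thesis unfolding near_iff_nbhd[OF assms(1)] by auto
qed

text \<open>Left multiplication by \<open>H\<close> acts on the Cayley graph, preserves \<open>H\<close>, and has finitely many orbits on
  each neighbourhood of \<open>H\<close>, represented by short words.\<close>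

lemma cut_contains_deep_component:
  assumes H: "subgroup H G" and cut: "cut H P"
  shows "\<exists>L0. \<forall>L \<ge> L0. \<exists>D \<in> deep_components (carrier G) (cayley_edges G S) H L. D \<subseteq> P"
proof -
  obtain L0 where L0: "\<And>g s. g \<in> carrier G \<Longrightarrow> s \<in> gens \<Longrightarrow> (g \<in> P) \<noteq> (g \<otimes> s \<in> P) \<Longrightarrow> g \<in> cayley_nbhd H L0"
    using cut_boundary[OF H cut] by blast
  have "\<exists>D \<in> deep_components (carrier G) (cayley_edges G S) H L. D \<subseteq> P" if L: "L \<ge> L0" for L
  proof (rule deep_component_subset[OF cayley_sym cayley_subset, where W = "ball_one (Suc L)"])
    show "\<exists>r. v \<in> cayley_nbhd H r" if "v \<in> carrier G" for v using mem_cayley_nbhd[OF H that] .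
    show "P \<subseteq> carrier G" "\<not> P \<subseteq> cayley_nbhd H r" for r
      using cut near_iff_nbhd[OF H] unfolding cut_def by auto
    show "u \<in> cayley_nbhd H L" if "(u, v) \<in> cayley_edges G S" "u \<in> P" "v \<notin> P" for u v
      using that L0 nbhd_mono[OF L, of "carrier G" "cayley_edges G S" H]
      unfolding cayley_edges_iff by blast
    show "finite (ball_one (Suc L))" by (rule finite_ball_one)
    fix y assume "y \<in> cayley_nbhd H (Suc L)"
    then obtain h w where hw: "h \<in> H" "w \<in> ball_one (Suc L)" "y = h \<otimes> w"
      unfolding cayley_nbhd_eq[OF H] r_coset_def by auto
    then have "inv h \<otimes> y = w"
      using ball_one_closed subgroup.mem_carrier[OF H] by (simp add: m_assoc[symmetric])
    then show "\<exists>\<alpha> \<beta>. graph_iso_pair (carrier G) (cayley_edges G S) H \<alpha> \<beta> \<and> \<alpha> y \<in> ball_one (Suc L)"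
      using left_mult_graph_iso_pair[OF H subgroup.m_inv_closed[OF H hw(1)]] hw by blast
  qed
  then show ?thesis by blast
qed

lemma cut_imp_coarsely_separating:
  assumes H: "subgroup H G" and cut: "cut H P"
  shows "coarsely_separating G S H"
proof -
  let ?d = "deep_components (carrier G) (cayley_edges G S) H"
  obtain L L' where L: "\<And>l. l \<ge> L \<Longrightarrow> \<exists>D \<in> ?d l. D \<subseteq> P"
    and L': "\<And>l. l \<ge> L' \<Longrightarrow> \<exists>D \<in> ?d l. D \<subseteq> carrier G - P"
    using cut_contains_deep_component[OF H cut] cut_contains_deep_component[OF H cut_complement[OF cut]]
    by metis
  obtain D D' where D: "D \<in> ?d (max L L')" "D \<subseteq> P" and "D' \<in> ?d (max L L')" "D' \<subseteq> carrier G - P"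
    using L[of "max L L'"] L'[of "max L L'"] by auto
  moreover have "D \<noteq> {}" using D(1) unfolding deep_components_def by blast
  ultimately have "D \<noteq> D'" by blast
  with D \<open>D' \<in> _\<close> show ?thesis
    unfolding coarsely_separating_def relative_coends_def coends_ge_2_iff using H by blast
qed

definition left_invariant :: "'a set \<Rightarrow> 'a set \<Rightarrow> bool" where
  "left_invariant K P \<longleftrightarrow> (\<forall>k \<in> K. \<forall>g \<in> P. k \<otimes> g \<in> P)"

lemma left_invariant_rcos_iff:
  assumes K: "subgroup K G" and inv: "left_invariant K P" and P: "P \<subseteq> carrier G" and g: "g \<in> carrier G"
  shows "K #> g \<in> (\<lambda>g. K #> g) ` P \<longleftrightarrow> g \<in> P"
proof
  assume "K #> g \<in> (\<lambda>g. K #> g) ` P"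
  then obtain p where p: "p \<in> P" "K #> g = K #> p" by auto
  then have "g \<in> K #> p" using rcos_self[OF g K] by auto
  then show "g \<in> P" using p inv unfolding r_coset_def left_invariant_def by auto
qed auto

lemma left_invariant_complement:
  assumes K: "subgroup K G" and "left_invariant K P" and P: "P \<subseteq> carrier G"
  shows "left_invariant K (carrier G - P)"
proof -
  have "k \<otimes> g \<in> carrier G - P" if k: "k \<in> K" and g: "g \<in> carrier G - P" for k g
  proof -
    have kG: "k \<in> carrier G" using subgroup.mem_carrier[OF K k] .
    have "g = inv k \<otimes> (k \<otimes> g)" using kG g by (simp add: m_assoc[symmetric])
    moreover have "inv k \<in> K" using subgroup.m_inv_closed[OF K k] .
    ultimately show ?thesis using assms(2) g kG unfolding left_invariant_def by (metis Diff_iff m_closed)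
  qed
  then show ?thesis unfolding left_invariant_def by blast
qed

lemma finite_imp_schreier_nbhd:
  assumes K: "subgroup K G" and "finite C" "C \<subseteq> rcosets K"
  shows "\<exists>r. C \<subseteq> schreier_nbhd K r"
proof -
  have "C \<subseteq> (\<lambda>g. K #> g) ` carrier G" using assms(3) unfolding RCOSETS_def by auto
  then obtain F where "F \<subseteq> carrier G" "finite F" "C = (\<lambda>g. K #> g) ` F"
    using finite_subset_image[OF assms(2)] by blast
  moreover from this obtain r where "F \<subseteq> ball_one r" using ball_one_cover_finite[of F] by blast
  ultimately show ?thesis unfolding schreier_nbhd_eq[OF K] by blast
qed

lemma schreier_ball_finite:
  assumes K: "subgroup K G" and v: "v \<in> rcosets K"
  shows "finite (graph_ball (rcosets K) (schreier_edges G S K) v r)"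
proof -
  obtain g where "g \<in> carrier G" "v = K #> g" using v unfolding RCOSETS_def by blast
  then show ?thesis using schreier_ball_eq[OF K] finite_ball_one by simp
qed

lemma rcosets_self:
  assumes "subgroup K G"
  shows "K \<in> rcosets K"
  using rcosetsI[OF subgroup.subset[OF assms] one_closed] coset_mult_one[OF subgroup.subset[OF assms]]
  by simp

text \<open>Invariance makes \<open>P\<close> the full preimage of a set of cosets. The Schreier graph is locally finite, so the
  identity is all the symmetry that is needed to have finitely many vertices at each distance.\<close>

lemma invariant_cut_contains_deep_component:
  assumes K: "subgroup K G" and cut: "cut K P" and inv: "left_invariant K P"
  shows "\<exists>L0. \<forall>L \<ge> L0. \<exists>D \<in> deep_components (rcosets K) (schreier_edges G S K) {K} L.
    D \<subseteq> (\<lambda>g. K #> g) ` P"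
proof -
  obtain L0 where L0: "\<And>g s. g \<in> carrier G \<Longrightarrow> s \<in> gens \<Longrightarrow> (g \<in> P) \<noteq> (g \<otimes> s \<in> P) \<Longrightarrow> g \<in> cayley_nbhd K L0"
    using cut_boundary[OF K cut] by blast
  have P: "P \<subseteq> carrier G" using cut unfolding cut_def by auto
  let ?P = "(\<lambda>g. K #> g) ` P"
  have "\<exists>D \<in> deep_components (rcosets K) (schreier_edges G S K) {K} L. D \<subseteq> ?P" if L: "L \<ge> L0" for L
  proof (rule deep_component_subset[OF schreier_sym schreier_subset[OF K], where W = "schreier_nbhd K (Suc L)"])
    show "\<exists>r. v \<in> schreier_nbhd K r" if "v \<in> rcosets K" for v
      using finite_imp_schreier_nbhd[OF K, of "{v}"] that by simp
    show "?P \<subseteq> rcosets K" using P rcosetsI[OF subgroup.subset[OF K]] by blast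
    show "\<not> ?P \<subseteq> schreier_nbhd K r" for r
    proof
      assume "?P \<subseteq> schreier_nbhd K r"
      then have "g \<in> cayley_nbhd K r" if "g \<in> P" for g
        using P that rcos_in_schreier_nbhd_iff[OF K, of g r] by blast
      then have "P \<subseteq> cayley_nbhd K r" by blast
      then show False using cut near_iff_nbhd[OF K] unfolding cut_def by auto
    qed
    show "u \<in> schreier_nbhd K L" if uv: "(u, v) \<in> schreier_edges G S K" "u \<in> ?P" "v \<notin> ?P" for u v
    proof -
      obtain g s where g: "g \<in> carrier G" "s \<in> gens" "u = K #> g" "v = K #> (g \<otimes> s)"
        using uv(1) unfolding schreier_edges_iff[OF K] by blast
      then have "g \<in> P" "g \<otimes> s \<notin> P"
        using uv left_invariant_rcos_iff[OF K inv P, of g] gens_closed by (simp, blast)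
      then have "g \<in> cayley_nbhd K L" using L0[OF g(1,2)] nbhd_mono[OF L, of "carrier G" "cayley_edges G S" K] by auto
      then show ?thesis using g rcos_in_schreier_nbhd_iff[OF K] by auto
    qed
    show "finite (schreier_nbhd K (Suc L))" unfolding schreier_nbhd_eq[OF K] using finite_ball_one by simp
    fix y assume "y \<in> schreier_nbhd K (Suc L)"
    moreover have "graph_iso_pair (rcosets K) (schreier_edges G S K) {K} id id"
      by (auto simp: graph_iso_pair_def)
    ultimately show "\<exists>\<alpha> \<beta>. graph_iso_pair (rcosets K) (schreier_edges G S K) {K} \<alpha> \<beta> \<and> \<alpha> y \<in> schreier_nbhd K (Suc L)"
      by (intro exI[of _ id] conjI) simp_all
  qed
  then show ?thesis by blast
qed

lemma schreier_bounded_iff: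
  assumes K: "subgroup K G" and C: "C \<subseteq> rcosets K"
  shows "bounded_in (rcosets K) (schreier_edges G S K) C \<longleftrightarrow> finite C"
proof
  assume "bounded_in (rcosets K) (schreier_edges G S K) C"
  then obtain v r where v: "v \<in> rcosets K" and sub: "C \<subseteq> graph_ball (rcosets K) (schreier_edges G S K) v r"
    unfolding bounded_in_def by blast
  from sub schreier_ball_finite[OF K v] show "finite C" by (rule finite_subset)
next
  assume "finite C"
  from finite_imp_schreier_nbhd[OF K this C] obtain r where "C \<subseteq> schreier_nbhd K r" ..
  then show "bounded_in (rcosets K) (schreier_edges G S K) C"
    unfolding bounded_in_def graph_ball_def using rcosets_self[OF K]
    by (intro bexI[where x = K] exI[where x = r])
qed

lemma deep_schreier_component:
  assumes K: "subgroup K G" and D: "D \<in> deep_components (rcosets K) (schreier_edges G S K) {K} L"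
  shows "D \<in> components_on (schreier_edges G S K)
      (rcosets K - graph_ball (rcosets K) (schreier_edges G S K) K L)"
    and "\<not> bounded_in (rcosets K) (schreier_edges G S K) D"
proof -
  show 1: "D \<in> components_on (schreier_edges G S K)
      (rcosets K - graph_ball (rcosets K) (schreier_edges G S K) K L)"
    using D unfolding deep_components_def graph_ball_def by simp
  have DK: "D \<subseteq> rcosets K" using components_on_subset[OF 1] by blast
  show "\<not> bounded_in (rcosets K) (schreier_edges G S K) D"
    unfolding schreier_bounded_iff[OF K DK]
  proof
    assume "finite D"
    from finite_imp_schreier_nbhd[OF K this DK] obtain r where "D \<subseteq> schreier_nbhd K r" ..
    moreover obtain x where "x \<in> D" "x \<notin> schreier_nbhd K r"
      using D unfolding deep_components_def by blast
    ultimately show False by blast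
  qed
qed

text \<open>From an unbounded component of the complement of a ball in the Schreier graph one obtains a cut by
  taking preimages: every edge that leaves the component ends in the ball.
  Conversely, an invariant cut and its complement each contain an unbounded component.\<close>

lemma codimension_one_iff_invariant_cut:
  assumes K: "subgroup K G"
  shows "codimension_one G S K \<longleftrightarrow> (\<exists>P. cut K P \<and> left_invariant K P)"
proof
  let ?V = "rcosets K" and ?E = "schreier_edges G S K"
  assume "\<exists>P. cut K P \<and> left_invariant K P"
  then obtain P where P: "cut K P" "left_invariant K P" by auto
  let ?d = "deep_components ?V ?E {K}"
  let ?Q = "carrier G - P"
  have PG: "P \<subseteq> carrier G" using P unfolding cut_def by auto
  have Q: "cut K ?Q" "left_invariant K ?Q"
    using cut_complement[OF P(1)] left_invariant_complement[OF K P(2) PG] by auto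
  from invariant_cut_contains_deep_component[OF K P]
  obtain L where L: "\<forall>l \<ge> L. \<exists>D \<in> ?d l. D \<subseteq> (\<lambda>g. K #> g) ` P" ..
  from invariant_cut_contains_deep_component[OF K Q]
  obtain L' where L': "\<forall>l \<ge> L'. \<exists>D \<in> ?d l. D \<subseteq> (\<lambda>g. K #> g) ` ?Q" ..
  from L[rule_format, of "max L L'"]
  obtain D where D: "D \<in> ?d (max L L')" "D \<subseteq> (\<lambda>g. K #> g) ` P" by auto
  from L'[rule_format, of "max L L'"]
  obtain D' where D': "D' \<in> ?d (max L L')" "D' \<subseteq> (\<lambda>g. K #> g) ` ?Q" by auto
  have "D \<noteq> D'"
  proof
    assume "D = D'"
    moreover obtain U where U: "U \<in> D" using D(1) unfolding deep_components_def by blast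
    ultimately obtain p where p: "p \<in> ?Q" "U = K #> p" using D'(2) by auto
    with U D(2) have "K #> p \<in> (\<lambda>g. K #> g) ` P" by auto
    with p(1) show False using left_invariant_rcos_iff[OF K P(2) PG, of p] by simp
  qed
  then have "\<exists>C \<in> components_on ?E (?V - graph_ball ?V ?E K (max L L')).
      \<exists>C' \<in> components_on ?E (?V - graph_ball ?V ?E K (max L L')).
        C \<noteq> C' \<and> \<not> bounded_in ?V ?E C \<and> \<not> bounded_in ?V ?E C'"
    using deep_schreier_component[OF K D(1)] deep_schreier_component[OF K D'(1)] by metis
  then show "codimension_one G S K"
    unfolding codimension_one_def relative_ends_def ends_ge_2_iff using K rcosets_self[OF K] by blast
next
  let ?V = "rcosets K" and ?E = "schreier_edges G S K"
  assume "codimension_one G S K"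
  then have "2 \<le> ends ?V ?E" unfolding codimension_one_def relative_ends_def by simp
  then obtain v r C C' where v: "v \<in> ?V"
    and C: "C \<in> components_on ?E (?V - graph_ball ?V ?E v r)"
    and C': "C' \<in> components_on ?E (?V - graph_ball ?V ?E v r)"
    and "C \<noteq> C'" and unb: "\<not> bounded_in ?V ?E C" "\<not> bounded_in ?V ?E C'"
    unfolding ends_ge_2_iff by (elim bexE exE conjE)
  let ?B = "graph_ball ?V ?E v r"
  have disj: "C \<inter> C' = {}"
    using components_on_disjoint[OF schreier_sym C C' \<open>C \<noteq> C'\<close>] .
  have CV: "C \<subseteq> ?V - ?B" "C' \<subseteq> ?V - ?B"
    using C C' by (simp_all add: components_on_subset)
  have inf: "infinite C" "infinite C'"
    using unb CV schreier_bounded_iff[OF K, of C] schreier_bounded_iff[OF K, of C'] by blast+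
  define P where "P = {g \<in> carrier G. K #> g \<in> C}"
  have not_near: "\<not> near K U" if A: "infinite A" "A \<subseteq> ?V" "{g \<in> carrier G. K #> g \<in> A} \<subseteq> U" for A U
  proof
    assume "near K U"
    then obtain F where F: "finite F" "F \<subseteq> carrier G" "U \<subseteq> (\<Union>f \<in> F. K #> f)" unfolding near_def by auto
    have "A \<subseteq> (\<lambda>f. K #> f) ` F"
    proof (rule subsetI)
      fix Y assume Y: "Y \<in> A"
      then obtain g where g: "g \<in> carrier G" "Y = K #> g" using A(2) unfolding RCOSETS_def by blast
      then have "g \<in> U" using A(3) Y by auto
      then obtain f where "f \<in> F" "g \<in> K #> f" using F by auto
      then show "Y \<in> (\<lambda>f. K #> f) ` F" using repr_independence[of g K f] K F(2) g(2) by blast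
    qed
    then show False using A(1) F(1) finite_surj by blast
  qed
  have near: "near K {g \<in> carrier G. (g \<in> P) \<noteq> (g \<otimes> s \<in> P)}" if s: "s \<in> S" for s
  proof -
    have sG: "s \<in> carrier G" "s \<in> gens" using s S_closed unfolding gens_def by auto
    have "?B \<subseteq> ?V" unfolding graph_ball_def nbhd_def by simp
    from finite_imp_schreier_nbhd[OF K schreier_ball_finite[OF K v] this]
    obtain r' where r': "?B \<subseteq> schreier_nbhd K r'" ..
    have "g \<in> cayley_nbhd K r'" if "g \<in> carrier G" "K #> g \<in> ?B" for g
      using that r' rcos_in_schreier_nbhd_iff[OF K, of g r'] by blast
    then have nearB: "near K {g \<in> carrier G. K #> g \<in> ?B}"
      unfolding near_iff_nbhd[OF K] by blast
    have "{g \<in> carrier G. (g \<in> P) \<noteq> (g \<otimes> s \<in> P)}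
      \<subseteq> {g \<in> carrier G. K #> g \<in> ?B} \<union> (\<lambda>x. x \<otimes> inv s) ` {g \<in> carrier G. K #> g \<in> ?B}"
    proof
      fix g assume "g \<in> {g \<in> carrier G. (g \<in> P) \<noteq> (g \<otimes> s \<in> P)}"
      then have g: "g \<in> carrier G" "(K #> g \<in> C) \<noteq> (K #> (g \<otimes> s) \<in> C)" using sG unfolding P_def by auto
      have e: "(K #> g, K #> (g \<otimes> s)) \<in> ?E" unfolding schreier_edges_iff[OF K] using g sG by blast
      then have e': "(K #> (g \<otimes> s), K #> g) \<in> ?E" by (rule symD[OF schreier_sym])
      have V: "K #> g \<in> ?V" "K #> (g \<otimes> s) \<in> ?V"
        using g sG by (simp_all add: rcosetsI[OF subgroup.subset[OF K]])
      have "K #> g \<in> ?B \<or> K #> (g \<otimes> s) \<in> ?B"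
        using g(2) components_on_step[OF C _ e] components_on_step[OF C _ e'] V by blast
      moreover have "g = (g \<otimes> s) \<otimes> inv s" using g sG by (simp add: m_assoc)
      ultimately show "g \<in> {g \<in> carrier G. K #> g \<in> ?B} \<union> (\<lambda>x. x \<otimes> inv s) ` {g \<in> carrier G. K #> g \<in> ?B}"
        using g sG by blast
    qed
    moreover have "near K ((\<lambda>x. x \<otimes> inv s) ` {g \<in> carrier G. K #> g \<in> ?B})"
      using near_translate[OF subgroup.subset[OF K] nearB] sG by auto
    ultimately show ?thesis using near_Un[OF nearB] near_mono by blast
  qed
  have "\<not> near K P" using not_near[OF inf(1)] CV(1) unfolding P_def by auto
  moreover have "\<not> near K (carrier G - P)"
    using not_near[OF inf(2), of "carrier G - P"] CV(2) disj unfolding P_def by auto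
  ultimately have "cut K P" unfolding cut_def using near P_def by auto
  moreover have "left_invariant K P"
  proof -
    have "k \<otimes> g \<in> P" if "k \<in> K" "g \<in> P" for k g
    proof -
      have "g \<in> carrier G" using that P_def by auto
      moreover from this have "K #> (k \<otimes> g) = K #> g"
        using repr_independence[OF rcosI[OF that(1) subgroup.subset[OF K]] _ K] by simp
      ultimately show ?thesis using that subgroup.mem_carrier[OF K that(1)] unfolding P_def by auto
    qed
    then show ?thesis unfolding left_invariant_def by auto
  qed
  ultimately show "\<exists>P. cut K P \<and> left_invariant K P" by auto
qed

lemma near_subset_subgroup:
  assumes "near K U" "K \<subseteq> H"
  shows "near H U"
proof -
  obtain F where F: "finite F" "F \<subseteq> carrier G" "U \<subseteq> (\<Union>f \<in> F. K #> f)"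
    using assms(1) unfolding near_def by auto
  have "(\<Union>f \<in> F. K #> f) \<subseteq> (\<Union>f \<in> F. H #> f)"
    by (intro UN_mono subset_refl) (use assms(2) in \<open>auto simp: r_coset_def\<close>)
  with F show ?thesis unfolding near_def by (intro exI[of _ F] conjI) auto
qed

section \<open>Stabilizers of deep components\<close>

lemma near_trans:
  assumes H: "H \<subseteq> carrier G" "K \<subseteq> carrier G" and KH: "near K H" and U: "near H U"
  shows "near K U"
proof -
  obtain F where F: "finite F" "F \<subseteq> carrier G" "U \<subseteq> (\<Union>f \<in> F. H #> f)" using U unfolding near_def by auto
  have "near K (\<Union>f \<in> F. H #> f)"
  proof (rule near_UN[OF F(1)])
    fix f assume "f \<in> F"
    moreover have "H #> f = (\<lambda>x. x \<otimes> f) ` H" unfolding r_coset_def by auto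
    ultimately show "near K (H #> f)" using near_translate[OF H(2) KH, of f] F(2) by auto
  qed
  then show ?thesis using F(3) by (rule near_mono)
qed

lemma near_cayley_nbhd:
  assumes "subgroup H G"
  shows "near H (cayley_nbhd H r)"
  unfolding near_iff_nbhd[OF assms] by (rule exI) (rule subset_refl)

lemma rcosets_restrict: "rcosets\<^bsub>G\<lparr>carrier := H\<rparr>\<^esub> K = (\<lambda>h. K #> h) ` H"
  unfolding RCOSETS_def r_coset_def by auto

lemma finite_index_subgroupD:
  assumes H: "subgroup H G" and K: "finite_index_subgroup K (G\<lparr>carrier := H\<rparr>)"
  shows "subgroup K G" "K \<subseteq> H" "near K H"
proof -
  have sub: "subgroup K (G\<lparr>carrier := H\<rparr>)" using K unfolding finite_index_subgroup_def by auto
  show KG: "subgroup K G" by (rule incl_subgroup[OF H sub])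
  show "K \<subseteq> H" using subgroup.subset[OF sub] by simp
  have fin: "finite ((\<lambda>h. K #> h) ` H)"
    using K unfolding finite_index_subgroup_def rcosets_restrict by simp
  obtain F where F: "F \<subseteq> H" "finite F" "(\<lambda>h. K #> h) ` H = (\<lambda>h. K #> h) ` F"
    using finite_subset_image[OF fin subset_refl] by blast
  have "h \<in> (\<Union>f \<in> F. K #> f)" if h: "h \<in> H" for h
  proof -
    have "h \<in> K #> h" using rcos_self[OF subgroup.mem_carrier[OF H h] KG] .
    moreover obtain f where "f \<in> F" "K #> h = K #> f"
      using F(3) imageI[OF h, of "\<lambda>h. K #> h"] by auto
    ultimately show ?thesis by auto
  qed
  then have "H \<subseteq> (\<Union>f \<in> F. K #> f)" by (rule subsetI)
  then show "near K H" unfolding near_def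
    using F subgroup.subset[OF H] by (intro exI[of _ F] conjI) auto
qed

text \<open>Elements with the same value of \<open>f\<close> lie in the same right coset, so there are at most as many cosets
  as values. For an orbit map, \<open>f\<close> has to send \<open>h\<close> to the translate by \<open>inv h\<close>, because the cosets
  are right cosets.\<close>

lemma finite_index_subgroupI:
  assumes H: "subgroup H G" and K: "subgroup K G" "K \<subseteq> H"
    and fin: "finite (f ` H)" and sep: "\<And>h h'. h \<in> H \<Longrightarrow> h' \<in> H \<Longrightarrow> f h = f h' \<Longrightarrow> h \<otimes> inv h' \<in> K"
  shows "finite_index_subgroup K (G\<lparr>carrier := H\<rparr>)"
proof -
  let ?r = "\<lambda>x. K #> (SOME h. h \<in> H \<and> f h = x)"
  have "K #> h \<in> ?r ` f ` H" if h: "h \<in> H" for h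
  proof -
    define h' where "h' = (SOME h'. h' \<in> H \<and> f h' = f h)"
    have h': "h' \<in> H \<and> f h' = f h" unfolding h'_def by (rule someI[of _ h]) (use h in auto)
    have hG: "h \<in> carrier G" "h' \<in> carrier G" using h h' subgroup.mem_carrier[OF H] by auto
    have "h \<otimes> inv h' \<in> K" using sep h h' by auto
    then have "h \<in> K #> h'" unfolding r_coset_def using hG by (auto intro!: bexI[of _ "h \<otimes> inv h'"] simp: m_assoc)
    then have "K #> h = K #> h'" using repr_independence[OF _ hG(2) K(1)] by auto
    then show ?thesis unfolding h'_def using h by blast
  qed
  then have "(\<lambda>h. K #> h) ` H \<subseteq> ?r ` f ` H" by (rule image_subsetI)
  then have "finite ((\<lambda>h. K #> h) ` H)" using fin by (rule finite_subset[OF _ finite_imageI])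
  then show ?thesis unfolding finite_index_subgroup_def rcosets_restrict using subgroup_incl[OF K(1) H K(2)] by simp
qed

abbreviation deep_comps :: "'a set \<Rightarrow> nat \<Rightarrow> 'a set set" where
  "deep_comps H L \<equiv> deep_components (carrier G) (cayley_edges G S) H L"

definition stabilizer_in :: "'a set \<Rightarrow> 'a set \<Rightarrow> 'a set" where
  "stabilizer_in H D = {h \<in> H. (\<lambda>g. h \<otimes> g) ` D = D}"

lemma deep_comps_subset:
  assumes "D \<in> deep_comps H L"
  shows "D \<subseteq> carrier G - cayley_nbhd H L"
  by (rule components_on_subset[where E = "cayley_edges G S"])
    (use assms in \<open>simp add: deep_components_def\<close>)

lemma deep_comps_translate:
  "subgroup H G \<Longrightarrow> h \<in> H \<Longrightarrow> D \<in> deep_comps H L \<Longrightarrow> (\<lambda>g. h \<otimes> g) ` D \<in> deep_comps H L"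
  by (rule graph_iso_pair_deep_components[OF left_mult_graph_iso_pair])

lemma deep_comps_disjoint:
  assumes "D \<in> deep_comps H L" "D' \<in> deep_comps H L" "D \<noteq> D'"
  shows "D \<inter> D' = {}"
  by (rule components_on_disjoint[OF cayley_sym, where W = "carrier G - cayley_nbhd H L"])
    (use assms in \<open>simp_all add: deep_components_def\<close>)

lemma deep_comps_not_near:
  assumes "subgroup H G" "D \<in> deep_comps H L"
  shows "\<not> near H D"
proof -
  have "\<exists>x \<in> D. x \<notin> cayley_nbhd H r" for r using assms(2) unfolding deep_components_def by simp
  then show ?thesis unfolding near_iff_nbhd[OF assms(1)] by blast
qed

lemma translate_translate:
  assumes "D \<subseteq> carrier G" "a \<in> carrier G" "b \<in> carrier G"
  shows "(\<lambda>g. a \<otimes> g) ` (\<lambda>g. b \<otimes> g) ` D = (\<lambda>g. (a \<otimes> b) \<otimes> g) ` D"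
  unfolding image_image using assms by (intro image_cong) (auto simp: m_assoc subset_iff)

lemma translate_one: "D \<subseteq> carrier G \<Longrightarrow> (\<lambda>g. \<one> \<otimes> g) ` D = D"
  by (auto simp: subset_iff image_iff)

lemma translate_eq_imp_stabilizer:
  assumes H: "subgroup H G" and D: "D \<subseteq> carrier G" and h: "a \<in> H" "b \<in> H"
    and eq: "(\<lambda>g. a \<otimes> g) ` D = (\<lambda>g. b \<otimes> g) ` D"
  shows "inv a \<otimes> b \<in> stabilizer_in H D"
proof -
  have G: "a \<in> carrier G" "b \<in> carrier G" using h subgroup.mem_carrier[OF H] by auto
  have "(\<lambda>g. (inv a \<otimes> b) \<otimes> g) ` D = (\<lambda>g. inv a \<otimes> g) ` (\<lambda>g. b \<otimes> g) ` D"
    using translate_translate[OF D] G by simp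
  also have "\<dots> = (\<lambda>g. inv a \<otimes> g) ` (\<lambda>g. a \<otimes> g) ` D" using eq by simp
  also have "\<dots> = D" using translate_translate[OF D, of "inv a" a] G translate_one[OF D] by simp
  finally show ?thesis unfolding stabilizer_in_def
    using h H by (auto simp: subgroup.m_closed subgroup.m_inv_closed)
qed

lemma stabilizer_subgroup:
  assumes H: "subgroup H G" and D: "D \<subseteq> carrier G"
  shows "subgroup (stabilizer_in H D) G"
proof (rule subgroupI)
  have HG: "h \<in> carrier G" if "h \<in> H" for h using subgroup.mem_carrier[OF H that] .
  show "stabilizer_in H D \<subseteq> carrier G" unfolding stabilizer_in_def using HG by auto
  have "\<one> \<in> stabilizer_in H D"
    unfolding stabilizer_in_def using subgroup.one_closed[OF H] translate_one[OF D] by simp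
  then show "stabilizer_in H D \<noteq> {}" by auto
  fix a assume a: "a \<in> stabilizer_in H D"
  then have "(\<lambda>g. a \<otimes> g) ` D = (\<lambda>g. \<one> \<otimes> g) ` D" "a \<in> H"
    unfolding stabilizer_in_def using translate_one[OF D] by auto
  from translate_eq_imp_stabilizer[OF H D this(2) subgroup.one_closed[OF H] this(1)]
  show "inv a \<in> stabilizer_in H D" using HG[OF \<open>a \<in> H\<close>] by simp
  fix b assume b: "b \<in> stabilizer_in H D"
  have "(\<lambda>g. (a \<otimes> b) \<otimes> g) ` D = (\<lambda>g. a \<otimes> g) ` (\<lambda>g. b \<otimes> g) ` D"
    using translate_translate[OF D, of a b] a b HG unfolding stabilizer_in_def by simp
  also have "\<dots> = D" using a b unfolding stabilizer_in_def by simp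
  finally show "a \<otimes> b \<in> stabilizer_in H D"
    using a b subgroup.m_closed[OF H] unfolding stabilizer_in_def by simp
qed

text \<open>The one point that uses \<open>stabilizer_in H D \<subseteq> M\<close> is that the part of the union \<open>P\<close> of the
  translates in a coset \<open>H f\<close> lies in a single coset of \<open>M\<close>: if \<open>b p\<close> and \<open>p\<close> are both in \<open>P\<close> with \<open>b\<close> in
  \<open>H\<close>, then \<open>b\<close> moves one translate of \<open>D\<close> to another one, hence is a product of elements of \<open>M\<close> and of
  an element that stabilizes \<open>D\<close>.\<close>

lemma orbit_of_deep_component_cut:
  assumes H: "subgroup H G" and M: "subgroup M G" "M \<subseteq> H" "stabilizer_in H D \<subseteq> M"
    and D: "D \<in> deep_comps H L" and D': "D' \<in> deep_comps H L"
    and other: "\<And>m. m \<in> M \<Longrightarrow> (\<lambda>g. m \<otimes> g) ` D \<noteq> D'"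
  shows "codimension_one G S M"
proof -
  define P where "P = (\<Union>m \<in> M. (\<lambda>g. m \<otimes> g) ` D)"
  have HG: "h \<in> carrier G" if "h \<in> H" for h using subgroup.mem_carrier[OF H that] .
  have MG: "m \<in> carrier G" if "m \<in> M" for m using HG M that by auto
  have DG: "D \<subseteq> carrier G" using deep_comps_subset[OF D] by auto
  have PG: "P \<subseteq> carrier G" unfolding P_def using DG MG by auto
  have inv: "left_invariant M P"
  proof -
    have "m \<otimes> g \<in> P" if m: "m \<in> M" and g: "g \<in> P" for m g
    proof -
      obtain m' d where "m' \<in> M" "d \<in> D" "g = m' \<otimes> d" using g unfolding P_def by auto
      then have "m \<otimes> g = (m \<otimes> m') \<otimes> d" "m \<otimes> m' \<in> M"
        using m MG DG subgroup.m_closed[OF M(1)] by (auto simp: m_assoc)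
      then show ?thesis unfolding P_def using \<open>d \<in> D\<close> by blast
    qed
    then show ?thesis unfolding left_invariant_def by auto
  qed
  have near_M: "near M (P \<inter> U)" if U: "near H U" for U
  proof -
    have coset: "near M (P \<inter> (H #> f))" if f: "f \<in> carrier G" for f
    proof (cases "P \<inter> (H #> f) = {}")
      case True
      then show ?thesis unfolding near_def by (intro exI[of _ "{}"]) auto
    next
      case False
      then obtain p where p: "p \<in> P" "p \<in> H #> f" by auto
      have "x \<in> M #> p" if x: "x \<in> P" "x \<in> H #> f" for x
      proof -
        obtain h h' where h: "h \<in> H" "x = h \<otimes> f" "h' \<in> H" "p = h' \<otimes> f"
          using p x unfolding r_coset_def by auto
        obtain m m' d d' where m: "m \<in> M" "d \<in> D" "x = m \<otimes> d" "m' \<in> M" "d' \<in> D" "p = m' \<otimes> d'"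
          using p x unfolding P_def by auto
        note G = HG[OF h(1)] HG[OF h(3)] MG[OF m(1)] MG[OF m(4)] f
        have dG: "d \<in> carrier G" "d' \<in> carrier G" using m DG by auto
        define b where "b = h \<otimes> inv h'"
        have b: "b \<in> H" "b \<in> carrier G"
          using h subgroup.m_closed[OF H] subgroup.m_inv_closed[OF H] G unfolding b_def by auto
        have xb: "x = b \<otimes> p"
          unfolding b_def h(2,4) using G by (simp add: m_assoc[symmetric]) (simp add: m_assoc)
        \<comment> \<open>\<open>a\<close> maps \<open>d'\<close> to \<open>d\<close>, so it stabilizes \<open>D\<close>.\<close>
        define a where "a = inv m \<otimes> (b \<otimes> m')"
        have aH: "a \<in> H" unfolding a_def
          by (intro subgroup.m_closed[OF H] subgroup.m_inv_closed[OF H]) (use b m M(2) in auto)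
        have "a \<otimes> d' = inv m \<otimes> (b \<otimes> p)" unfolding a_def m(6) using G b dG by (simp add: m_assoc)
        also have "\<dots> = inv m \<otimes> (m \<otimes> d)" using xb m by simp
        also have "\<dots> = d" using G dG by (simp add: m_assoc[symmetric])
        finally have "d \<in> (\<lambda>g. a \<otimes> g) ` D" using m(5) by auto
        then have "(\<lambda>g. a \<otimes> g) ` D = D"
          using deep_comps_disjoint[OF deep_comps_translate[OF H aH D] D] m(2) by blast
        then have "a \<in> M" using aH M(3) unfolding stabilizer_in_def by auto
        moreover have "b = m \<otimes> (a \<otimes> inv m')" unfolding a_def
          using G b by (simp add: m_assoc) (simp add: m_assoc[symmetric])
        ultimately have "b \<in> M"
          using m subgroup.m_closed[OF M(1)] subgroup.m_inv_closed[OF M(1)] by auto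
        then show ?thesis unfolding r_coset_def xb by auto
      qed
      then show ?thesis unfolding near_def using p PG by (intro exI[of _ "{p}"]) auto
    qed
    obtain F where F: "finite F" "F \<subseteq> carrier G" "U \<subseteq> (\<Union>f \<in> F. H #> f)" using U unfolding near_def by auto
    have "near M (\<Union>f \<in> F. P \<inter> (H #> f))" by (rule near_UN[OF F(1)]) (use coset F in auto)
    then show ?thesis by (rule near_mono) (use F in blast)
  qed
  have leave: "g \<otimes> s \<in> cayley_nbhd H L" if g: "g \<in> P" "s \<in> gens" "g \<otimes> s \<notin> P" for g s
  proof (rule ccontr)
    assume out: "g \<otimes> s \<notin> cayley_nbhd H L"
    obtain m where m: "m \<in> M" "g \<in> (\<lambda>g. m \<otimes> g) ` D" using g(1) unfolding P_def by blast
    have "(\<lambda>g. m \<otimes> g) ` D \<in> deep_comps H L" using deep_comps_translate[OF H _ D] m M by auto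
    then have "(\<lambda>g. m \<otimes> g) ` D \<in> components_on (cayley_edges G S) (carrier G - cayley_nbhd H L)"
      unfolding deep_components_def by simp
    moreover have "(g, g \<otimes> s) \<in> cayley_edges G S" "g \<otimes> s \<in> carrier G - cayley_nbhd H L"
      using g PG out gens_closed by (auto simp: cayley_edges_iff)
    ultimately have "g \<otimes> s \<in> (\<lambda>g. m \<otimes> g) ` D"
      using components_on_step[OF _ m(2)] by simp
    then show False using g(3) m(1) unfolding P_def by blast
  qed
  have "near M {g \<in> carrier G. (g \<in> P) \<noteq> (g \<otimes> s \<in> P)}" if s: "s \<in> S" for s
  proof -
    let ?N = "cayley_nbhd H L"
    have sG: "s \<in> carrier G" "s \<in> gens" using s S_closed unfolding gens_def by auto
    \<comment> \<open>An edge between \<open>P\<close> and its complement has its outer endpoint in the neighbourhood of \<open>H\<close>;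
      \<open>?U1\<close> covers the edges whose first endpoint is in \<open>P\<close>, and \<open>?U2\<close> the others.\<close>
    let ?U1 = "P \<inter> (\<lambda>x. x \<otimes> inv s) ` ?N" and ?U2 = "(\<lambda>x. x \<otimes> inv s) ` (P \<inter> (\<lambda>x. x \<otimes> s) ` ?N)"
    note N = near_cayley_nbhd[OF H, of L]
    note tr = near_translate[OF subgroup.subset[OF H]] near_translate[OF subgroup.subset[OF M(1)]]
    have near1: "near M ?U1" by (rule near_M[OF tr(1)[OF N inv_closed[OF sG(1)]]])
    have near2: "near M ?U2" by (rule tr(2)[OF near_M[OF tr(1)[OF N sG(1)]] inv_closed[OF sG(1)]])
    have "g \<in> ?U1 \<union> ?U2" if g: "g \<in> carrier G" "(g \<in> P) \<noteq> (g \<otimes> s \<in> P)" for g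
    proof -
      have e: "g = (g \<otimes> s) \<otimes> inv s" using g sG by (simp add: m_assoc)
      show ?thesis
      proof (cases "g \<in> P")
        case True
        then have "g \<otimes> s \<in> ?N" using leave sG g by auto
        then have "g \<in> (\<lambda>x. x \<otimes> inv s) ` ?N" using e by (rule rev_image_eqI)
        then show ?thesis using True by blast
      next
        case False
        then have gs: "g \<otimes> s \<in> P" using g by auto
        have "g \<in> ?N" using leave[OF gs gens_inv[OF sG(2)]] False e by simp
        then have "g \<otimes> s \<in> P \<inter> (\<lambda>x. x \<otimes> s) ` ?N" using gs by blast
        then have "g \<in> ?U2" using e by (rule rev_image_eqI)
        then show ?thesis by blast
      qed
    qed
    then have "{g \<in> carrier G. (g \<in> P) \<noteq> (g \<otimes> s \<in> P)} \<subseteq> ?U1 \<union> ?U2" by blast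
    then show ?thesis by (rule near_mono[OF near_Un[OF near1 near2]])
  qed
  moreover have "\<not> near M P"
  proof
    assume "near M P"
    moreover have "D \<subseteq> P"
      unfolding P_def using translate_one[OF DG] subgroup.one_closed[OF M(1)] by blast
    ultimately have "near M D" by (rule near_mono)
    then have "near H D" using M(2) by (rule near_subset_subgroup)
    then show False using deep_comps_not_near[OF H D] by auto
  qed
  moreover have "\<not> near M (carrier G - P)"
  proof
    assume "near M (carrier G - P)"
    moreover have "D' \<subseteq> carrier G - P"
    proof -
      have "D' \<inter> (\<lambda>g. m \<otimes> g) ` D = {}" if "m \<in> M" for m
        using deep_comps_disjoint[OF D' deep_comps_translate[OF H _ D]] other[OF that] M(2) that by auto
      then show ?thesis unfolding P_def using deep_comps_subset[OF D'] by blast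
    qed
    ultimately have "near M D'" by (rule near_mono)
    then have "near H D'" using M(2) by (rule near_subset_subgroup)
    then show False using deep_comps_not_near[OF H D'] by auto
  qed
  ultimately have "cut M P" unfolding cut_def using PG by auto
  then show ?thesis unfolding codimension_one_iff_invariant_cut[OF M(1)] using inv by auto
qed

lemma coarsely_separatingE:
  assumes "coarsely_separating G S H"
  obtains L D D' where "D \<in> deep_comps H L" "D' \<in> deep_comps H L" "D \<noteq> D'"
proof -
  have "\<exists>L. \<exists>D \<in> deep_comps H L. \<exists>D' \<in> deep_comps H L. D \<noteq> D'"
    using assms unfolding coarsely_separating_def relative_coends_def coends_ge_2_iff by simp
  then show thesis by (elim exE bexE) (rule that)
qed

lemma codimension_one_imp_coarsely_separating:
  assumes "codimension_one G S H"
  shows "coarsely_separating G S H"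
proof -
  have H: "subgroup H G" using assms unfolding codimension_one_def by simp
  obtain P where "cut H P" using assms unfolding codimension_one_iff_invariant_cut[OF H] by auto
  then show ?thesis by (rule cut_imp_coarsely_separating[OF H])
qed

lemma stabilizer_codimension_one:
  assumes H: "subgroup H G" and D: "D \<in> deep_comps H L" and D': "D' \<in> deep_comps H L" and ne: "D \<noteq> D'"
  shows "codimension_one G S (stabilizer_in H D)"
proof (rule orbit_of_deep_component_cut[OF H _ _ _ D D'])
  show "subgroup (stabilizer_in H D) G" using stabilizer_subgroup[OF H] deep_comps_subset[OF D] by auto
qed (use ne in \<open>auto simp: stabilizer_in_def\<close>)

lemma coarsely_separating_contains_codimension_one:
  assumes "coarsely_separating G S H"
  shows "\<exists>K. K \<subseteq> H \<and> codimension_one G S K"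
proof -
  have H: "subgroup H G" using assms unfolding coarsely_separating_def by simp
  obtain L D D' where "D \<in> deep_comps H L" "D' \<in> deep_comps H L" "D \<noteq> D'"
    by (rule coarsely_separatingE[OF assms])
  then have "codimension_one G S (stabilizer_in H D)" by (rule stabilizer_codimension_one[OF H])
  moreover have "stabilizer_in H D \<subseteq> H" unfolding stabilizer_in_def by blast
  ultimately show ?thesis by blast
qed

lemma stabilizer_finite_index:
  assumes H: "subgroup H G" and D: "D \<subseteq> carrier G" and fin: "finite ((\<lambda>h. (\<lambda>g. h \<otimes> g) ` D) ` H)"
  shows "finite_index_subgroup (stabilizer_in H D) (G\<lparr>carrier := H\<rparr>)"
proof (rule finite_index_subgroupI[OF H stabilizer_subgroup[OF H D],
      where f = "\<lambda>h. (\<lambda>g. inv h \<otimes> g) ` D"])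
  show "stabilizer_in H D \<subseteq> H" unfolding stabilizer_in_def by auto
  have "(\<lambda>h. (\<lambda>g. inv h \<otimes> g) ` D) ` H \<subseteq> (\<lambda>h. (\<lambda>g. h \<otimes> g) ` D) ` H"
    using subgroup.m_inv_closed[OF H] by blast
  then show "finite ((\<lambda>h. (\<lambda>g. inv h \<otimes> g) ` D) ` H)" using fin finite_subset by blast
  fix h h' assume "h \<in> H" "h' \<in> H" "(\<lambda>g. inv h \<otimes> g) ` D = (\<lambda>g. inv h' \<otimes> g) ` D"
  then show "h \<otimes> inv h' \<in> stabilizer_in H D"
    using translate_eq_imp_stabilizer[OF H D, of "inv h" "inv h'"]
    by (simp add: subgroup.m_inv_closed[OF H] subgroup.mem_carrier[OF H])
qed

lemma finite_coends_imp_virtually_codimension_one: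
  assumes H: "subgroup H G" and "Finite 2 \<le> relative_coends G S H" and le: "relative_coends G S H \<le> Omega"
  shows "virtually_codimension_one G S H"
proof -
  have "coarsely_separating G S H" unfolding coarsely_separating_def using assms by simp
  then obtain L D D' where D: "D \<in> deep_comps H L" "D' \<in> deep_comps H L" "D \<noteq> D'"
    by (rule coarsely_separatingE)
  have "finite (deep_comps H L)" using le coends_le_Omega unfolding relative_coends_def by auto
  moreover have "(\<lambda>h. (\<lambda>g. h \<otimes> g) ` D) ` H \<subseteq> deep_comps H L"
    using deep_comps_translate[OF H _ D(1)] by auto
  ultimately have "finite_index_subgroup (stabilizer_in H D) (G\<lparr>carrier := H\<rparr>)"
    by (intro stabilizer_finite_index[OF H]) (use deep_comps_subset[OF D(1)] in \<open>auto intro: finite_subset\<close>)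
  then show ?thesis unfolding virtually_codimension_one_def using stabilizer_codimension_one[OF H D] by blast
qed

lemma virtually_codimension_one_imp_coarsely_separating:
  assumes H: "subgroup H G" and "virtually_codimension_one G S H"
  shows "coarsely_separating G S H"
proof -
  obtain K where fin: "finite_index_subgroup K (G\<lparr>carrier := H\<rparr>)" and K: "codimension_one G S K"
    using assms(2) unfolding virtually_codimension_one_def by auto
  note K' = finite_index_subgroupD[OF H fin]
  obtain P where P: "cut K P" using K unfolding codimension_one_iff_invariant_cut[OF K'(1)] by auto
  have "near H U = near K U" for U
    using near_trans[OF subgroup.subset[OF H] subgroup.subset[OF K'(1)] K'(3), of U]
      near_subset_subgroup[OF _ K'(2), of U] by (rule iffI)
  then have "cut H P" using P unfolding cut_def by simp
  then show ?thesis by (rule cut_imp_coarsely_separating[OF H])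
qed

lemma ERF_coarsely_separating_imp_virtually_codimension_one:
  assumes H: "subgroup H G" and ERF: "ERF (G\<lparr>carrier := H\<rparr>)" and sep: "coarsely_separating G S H"
  shows "virtually_codimension_one G S H"
proof -
  obtain L D D' where D: "D \<in> deep_comps H L" "D' \<in> deep_comps H L" "D \<noteq> D'"
    by (rule coarsely_separatingE[OF sep])
  have DG: "D \<subseteq> carrier G" using deep_comps_subset[OF D(1)] by auto
  let ?K = "stabilizer_in H D"
  have K: "subgroup ?K G" "?K \<subseteq> H" using stabilizer_subgroup[OF H DG] unfolding stabilizer_in_def by auto
  show ?thesis
  proof (cases "?K = H")
    case True
    then have "(\<lambda>g. h \<otimes> g) ` D = D" if "h \<in> H" for h using that unfolding stabilizer_in_def by blast
    then have "(\<lambda>h. (\<lambda>g. h \<otimes> g) ` D) ` H \<subseteq> {D}" by auto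
    then have "finite_index_subgroup ?K (G\<lparr>carrier := H\<rparr>)"
      by (intro stabilizer_finite_index[OF H DG]) (simp add: finite_subset)
    then show ?thesis unfolding virtually_codimension_one_def using stabilizer_codimension_one[OF H D] by blast
  next
    case False
    then obtain h where h: "h \<in> H" "h \<notin> ?K" using K(2) by auto
    have "separable_subgroup ?K (G\<lparr>carrier := H\<rparr>)"
      using ERF subgroup_incl[OF K(1) H K(2)] unfolding ERF_def by auto
    then obtain M where fin: "finite_index_subgroup M (G\<lparr>carrier := H\<rparr>)" and M: "?K \<subseteq> M" "h \<notin> M"
      using h unfolding separable_subgroup_def by auto
    note M' = finite_index_subgroupD[OF H fin]
    have "codimension_one G S M"
    proof (rule orbit_of_deep_component_cut[OF H M'(1,2) M(1) D(1) deep_comps_translate[OF H h(1) D(1)]])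
      fix m assume m: "m \<in> M"
      show "(\<lambda>g. m \<otimes> g) ` D \<noteq> (\<lambda>g. h \<otimes> g) ` D"
      proof
        assume "(\<lambda>g. m \<otimes> g) ` D = (\<lambda>g. h \<otimes> g) ` D"
        then have "inv m \<otimes> h \<in> M"
          using translate_eq_imp_stabilizer[OF H DG _ h(1)] m M'(2) M(1) by blast
        then have "m \<otimes> (inv m \<otimes> h) \<in> M" using subgroup.m_closed[OF M'(1) m] by blast
        moreover have "m \<otimes> (inv m \<otimes> h) = h"
          using subgroup.mem_carrier[OF M'(1) m] subgroup.mem_carrier[OF H h(1)]
          by (simp add: m_assoc[symmetric])
        ultimately show False using M(2) by simp
      qed
    qed
    then show ?thesis unfolding virtually_codimension_one_def using fin by blast
  qed
qed

end

type_synonym plane = "int \<times> int"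

section \<open>Bijections of the plane that are translations off a finite set\<close>

definition translation_off_finite :: "(plane \<Rightarrow> plane) \<Rightarrow> plane \<Rightarrow> bool" where
  "translation_off_finite f q \<longleftrightarrow> finite {x. f x \<noteq> x + q}"

definition almost_translations :: "(plane \<Rightarrow> plane) set" where
  "almost_translations = {f. bij f \<and> (\<exists>q. translation_off_finite f q)}"

definition displacement :: "(plane \<Rightarrow> plane) \<Rightarrow> plane" where
  "displacement f = (SOME q. translation_off_finite f q)"

lemma infinite_plane: "infinite (UNIV :: plane set)"
  by (simp add: finite_prod)

lemma almost_translationsI:
  "bij f \<Longrightarrow> translation_off_finite f q \<Longrightarrow> f \<in> almost_translations"
  unfolding almost_translations_def by blast

lemma displacement_eq:
  assumes "translation_off_finite f q"
  shows "displacement f = q"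
proof -
  define r where "r = displacement f"
  have "translation_off_finite f r"
    unfolding r_def displacement_def by (rule someI[of "translation_off_finite f", OF assms])
  then have "finite ({x. f x \<noteq> x + r} \<union> {x. f x \<noteq> x + q})"
    using assms unfolding translation_off_finite_def by simp
  then obtain x where "x \<notin> {x. f x \<noteq> x + r} \<union> {x. f x \<noteq> x + q}"
    using ex_new_if_finite[OF infinite_plane] by blast
  then have "x + r = x + q" by auto
  then show ?thesis unfolding r_def by simp
qed

lemma almost_translationsD:
  assumes "f \<in> almost_translations"
  shows "bij f" "translation_off_finite f (displacement f)"
  using assms displacement_eq unfolding almost_translations_def by auto

lemma translation_off_finite_comp:
  assumes "inj g" "translation_off_finite f q" "translation_off_finite g r"
  shows "translation_off_finite (f \<circ> g) (q + r)"
proof -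
  have "{x. (f \<circ> g) x \<noteq> x + (q + r)} \<subseteq> {x. g x \<noteq> x + r} \<union> g -` {y. f y \<noteq> y + q}"
    by (auto simp: algebra_simps)
  moreover have "finite (g -` {y. f y \<noteq> y + q})"
    using finite_vimageI[OF _ assms(1)] assms(2) unfolding translation_off_finite_def by blast
  ultimately show ?thesis
    using assms(3) unfolding translation_off_finite_def by (meson finite_UnI finite_subset)
qed

lemma translation_off_finite_inv:
  assumes "bij f" "translation_off_finite f q"
  shows "translation_off_finite (Hilbert_Choice.inv f) (- q)"
proof -
  have "{x. Hilbert_Choice.inv f x \<noteq> x + (- q)} \<subseteq> f ` {y. f y \<noteq> y + q}"
  proof
    fix x assume x: "x \<in> {x. Hilbert_Choice.inv f x \<noteq> x + (- q)}"
    have fx: "f (Hilbert_Choice.inv f x) = x" using assms(1) by (simp add: bij_is_surj surj_f_inv_f)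
    have "f (Hilbert_Choice.inv f x) \<noteq> Hilbert_Choice.inv f x + q"
    proof
      assume "f (Hilbert_Choice.inv f x) = Hilbert_Choice.inv f x + q"
      then have "Hilbert_Choice.inv f x = x + (- q)" using fx by (metis add_diff_cancel_right' uminus_add_conv_diff add.commute)
      with x show False by simp
    qed
    then show "x \<in> f ` {y. f y \<noteq> y + q}" using fx by (metis (mono_tags, lifting) image_eqI mem_Collect_eq)
  qed
  then show ?thesis using assms(2) unfolding translation_off_finite_def
    by (meson finite_imageI finite_subset)
qed

lemma almost_translations_comp:
  assumes "f \<in> almost_translations" "g \<in> almost_translations"
  shows "f \<circ> g \<in> almost_translations" "displacement (f \<circ> g) = displacement f + displacement g"
proof -
  note f = almost_translationsD[OF assms(1)] and g = almost_translationsD[OF assms(2)]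
  have off: "translation_off_finite (f \<circ> g) (displacement f + displacement g)"
    using translation_off_finite_comp[OF bij_is_inj[OF g(1)] f(2) g(2)] .
  then show "displacement (f \<circ> g) = displacement f + displacement g" by (rule displacement_eq)
  show "f \<circ> g \<in> almost_translations" by (rule almost_translationsI[OF bij_comp[OF g(1) f(1)] off])
qed

lemma almost_translations_inv: "f \<in> almost_translations \<Longrightarrow> Hilbert_Choice.inv f \<in> almost_translations"
  by (rule almost_translationsI[OF bij_imp_bij_inv translation_off_finite_inv])
    (erule almost_translationsD)+

lemma translation_almost_translation:
  "(\<lambda>x. x + q) \<in> almost_translations" "displacement (\<lambda>x. x + q) = q"
proof -
  have "translation_off_finite (\<lambda>x. x + q) q" unfolding translation_off_finite_def by simp
  moreover have "bij (\<lambda>x. x + q)" by (rule bij_betw_byWitness[where f' = "\<lambda>x. x - q"]) auto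
  ultimately show "(\<lambda>x. x + q) \<in> almost_translations" "displacement (\<lambda>x. x + q) = q"
    using almost_translationsI displacement_eq by blast+
qed

lemma transpose_almost_translation:
  "transpose x y \<in> almost_translations" "displacement (transpose x y) = 0"
proof -
  have "{z. transpose x y z \<noteq> z + 0} \<subseteq> {x, y}" by (auto simp: transpose_def)
  then have "translation_off_finite (transpose x y) 0"
    unfolding translation_off_finite_def by (rule finite_subset) simp
  moreover have "bij (transpose x y)" by simp
  ultimately show "transpose x y \<in> almost_translations" "displacement (transpose x y) = 0"
    using almost_translationsI displacement_eq by blast+
qed

definition almost_translation_group :: "(plane \<Rightarrow> plane) monoid" where
  "almost_translation_group = \<lparr>carrier = almost_translations, monoid.mult = (\<circ>), one = id\<rparr>"

lemma id_almost_translation: "id \<in> almost_translations"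
  using translation_almost_translation(1)[of 0] by (simp add: id_def)

lemma group_almost_translation_group: "group almost_translation_group"
proof (rule groupI)
  fix f assume "f \<in> carrier almost_translation_group"
  then have f: "f \<in> almost_translations" unfolding almost_translation_group_def by simp
  show "\<exists>g \<in> carrier almost_translation_group.
      g \<otimes>\<^bsub>almost_translation_group\<^esub> f = \<one>\<^bsub>almost_translation_group\<^esub>"
    using almost_translations_inv[OF f] almost_translationsD(1)[OF f]
    unfolding almost_translation_group_def by (auto intro!: bexI[of _ "Hilbert_Choice.inv f"] simp: bij_is_inj)
qed (auto simp: almost_translation_group_def id_almost_translation almost_translations_comp comp_assoc)

text \<open>Such a map is determined by its displacement and by its values at the finitely many points which it
  does not translate. Countability is what allows a copy of the group on the natural numbers.\<close>

lemma countable_almost_translations: "countable almost_translations"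
proof -
  define moved where "moved f = {p :: plane \<times> plane. snd p = f (fst p) \<and> f (fst p) \<noteq> fst p + displacement f}"
    for f
  let ?code = "\<lambda>f. (displacement f, moved f)"
  have "finite (moved f)" if "f \<in> almost_translations" for f
  proof -
    have "moved f \<subseteq> (\<lambda>x. (x, f x)) ` {x. f x \<noteq> x + displacement f}"
      unfolding moved_def by force
    then show ?thesis
      using almost_translationsD(2)[OF that] unfolding translation_off_finite_def
      by (meson finite_imageI finite_subset)
  qed
  then have "?code ` almost_translations \<subseteq> UNIV \<times> {F. finite F}" by blast
  moreover have "countable (UNIV \<times> {F. finite F} :: (plane \<times> (plane \<times> plane) set) set)"
    by (intro countable_SIGMA countable_Collect_finite) auto
  ultimately have "countable (?code ` almost_translations)" by (rule countable_subset)
  moreover have "inj_on ?code almost_translations"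
  proof (rule inj_onI)
    fix f g assume "?code f = ?code g"
    then have q: "displacement f = displacement g" and s: "moved f = moved g" by simp_all
    show "f = g"
    proof
      fix x
      have "(x, y) \<in> moved h \<longleftrightarrow> y = h x \<and> h x \<noteq> x + displacement h" for y h
        unfolding moved_def by simp
      then show "f x = g x" using q s by metis
    qed
  qed
  ultimately show ?thesis by (rule countable_image_inj_on)
qed

section \<open>Finite index and the geometry of the plane\<close>

text \<open>Each \<open>f i\<close> permutes the finitely many right cosets of \<open>K\<close>, so two of the infinitely many indices
  induce the same permutation; the quotient of the two elements then lies in the normal core of \<open>K\<close>.\<close>

lemma (in group) finite_index_core_pair:
  assumes H: "subgroup H G" and K: "finite_index_subgroup K (G\<lparr>carrier := H\<rparr>)"
    and I: "infinite I" and f: "\<And>i. i \<in> I \<Longrightarrow> f i \<in> H"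
  shows "\<exists>i \<in> I. \<exists>j \<in> I. i \<noteq> j \<and> (\<forall>h \<in> H. h \<otimes> (f i \<otimes> inv (f j)) \<otimes> inv h \<in> K)"
proof -
  have HG: "h \<in> carrier G" if "h \<in> H" for h using subgroup.mem_carrier[OF H that] .
  have sub: "subgroup K (G\<lparr>carrier := H\<rparr>)" using K unfolding finite_index_subgroup_def by auto
  have KG: "subgroup K G" by (rule incl_subgroup[OF H sub])
  define C where "C = (\<lambda>h. K #> h) ` H"
  have "rcosets\<^bsub>G\<lparr>carrier := H\<rparr>\<^esub> K = C" unfolding C_def RCOSETS_def r_coset_def by auto
  then have "finite C" using K unfolding finite_index_subgroup_def by simp
  define act where "act i = restrict (\<lambda>R. R #> f i) C" for i
  have mult: "(K #> h) #> f i = K #> (h \<otimes> f i)" if "h \<in> H" "i \<in> I" for h i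
    using coset_mult_assoc[OF subgroup.subset[OF KG] HG HG] that f by simp
  have "act ` I \<subseteq> C \<rightarrow>\<^sub>E C"
  proof (rule image_subsetI)
    fix i assume i: "i \<in> I"
    show "act i \<in> C \<rightarrow>\<^sub>E C" unfolding act_def restrict_PiE_iff
    proof
      fix R assume "R \<in> C"
      then obtain h where "h \<in> H" "R = K #> h" unfolding C_def by auto
      then show "R #> f i \<in> C" unfolding C_def using mult i f subgroup.m_closed[OF H] by auto
    qed
  qed
  then have "finite (act ` I)" using \<open>finite C\<close> by (meson finite_PiE finite_subset)
  then have "\<not> inj_on act I" using I finite_imageD by blast
  then obtain i j where ij: "i \<in> I" "j \<in> I" "i \<noteq> j" "act i = act j" unfolding inj_on_def by blast
  have "h \<otimes> (f i \<otimes> inv (f j)) \<otimes> inv h \<in> K" if h: "h \<in> H" for h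
  proof -
    have C: "K #> h \<in> C" using h unfolding C_def by auto
    have "act i (K #> h) = act j (K #> h)" using ij(4) by simp
    then have "(K #> h) #> f i = (K #> h) #> f j" unfolding act_def using C by simp
    then have eq: "K #> (h \<otimes> f i) = K #> (h \<otimes> f j)" using mult[OF h] ij(1,2) by simp
    note G = HG[OF h] HG[OF f[OF ij(1)]] HG[OF f[OF ij(2)]]
    have "h \<otimes> f i \<in> K #> (h \<otimes> f j)" using rcos_self[OF _ KG] G eq by blast
    then obtain k where k: "k \<in> K" "h \<otimes> f i = k \<otimes> (h \<otimes> f j)" unfolding r_coset_def by auto
    have kG: "k \<in> carrier G" using subgroup.mem_carrier[OF KG k(1)] .
    have "h \<otimes> (f i \<otimes> inv (f j)) \<otimes> inv h = (h \<otimes> f i) \<otimes> (inv (f j) \<otimes> inv h)" using G by (simp add: m_assoc)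
    also have "\<dots> = k \<otimes> ((h \<otimes> f j) \<otimes> inv (h \<otimes> f j))" using k G kG by (simp add: m_assoc inv_mult_group)
    also have "\<dots> = k" using G kG by simp
    finally show ?thesis using k by simp
  qed
  with ij show ?thesis by blast
qed

lemma (in group) conj_mult:
  assumes "h \<in> carrier G" "m \<in> carrier G" "n \<in> carrier G"
  shows "(h \<otimes> m \<otimes> inv h) \<otimes> (h \<otimes> n \<otimes> inv h) = h \<otimes> (m \<otimes> n) \<otimes> inv h"
proof -
  have "inv h \<otimes> (h \<otimes> (n \<otimes> inv h)) = n \<otimes> inv h" using assms by (simp add: m_assoc[symmetric])
  then show ?thesis using assms by (simp add: m_assoc)
qed

lemma finite_plane_box: "finite {q :: plane. \<bar>fst q\<bar> \<le> n \<and> \<bar>snd q\<bar> \<le> n}"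
proof (rule finite_subset)
  show "{q :: plane. \<bar>fst q\<bar> \<le> n \<and> \<bar>snd q\<bar> \<le> n} \<subseteq> {- n..n} \<times> {- n..n}" by auto
qed simp

lemma finite_in_plane_box:
  assumes "finite (F :: plane set)"
  shows "\<exists>n. F \<subseteq> {q. \<bar>fst q\<bar> \<le> n \<and> \<bar>snd q\<bar> \<le> n}"
  using assms
proof induction
  case (insert q F)
  then obtain n where "F \<subseteq> {q. \<bar>fst q\<bar> \<le> n \<and> \<bar>snd q\<bar> \<le> n}" by auto
  then have "insert q F \<subseteq> {r. \<bar>fst r\<bar> \<le> max n (max \<bar>fst q\<bar> \<bar>snd q\<bar>) \<and> \<bar>snd r\<bar> \<le> max n (max \<bar>fst q\<bar> \<bar>snd q\<bar>)}"
    by auto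
  then show ?case by blast
qed simp

lemma plane_induct:
  assumes "Q (1, 0)" "Q (0, 1)" "\<And>a b. Q a \<Longrightarrow> Q b \<Longrightarrow> Q (a + b)" "\<And>a. Q a \<Longrightarrow> Q (- a)"
  shows "Q (q :: plane)"
proof -
  have zero: "Q (0, 0)" using assms(3)[OF assms(1) assms(4)[OF assms(1)]] by simp
  have 1: "Q (k, 0)" for k
  proof (induction k rule: int_induct[where k = 0])
    case (step1 i) then show ?case using assms(3)[OF _ assms(1), of "(i, 0)"] by simp
  next
    case (step2 i) then show ?case using assms(3)[OF _ assms(4)[OF assms(1)], of "(i, 0)"] by simp
  qed (rule zero)
  have 2: "Q (0, k)" for k
  proof (induction k rule: int_induct[where k = 0])
    case (step1 i) then show ?case using assms(3)[OF _ assms(2), of "(0, i)"] by simp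
  next
    case (step2 i) then show ?case using assms(3)[OF _ assms(4)[OF assms(2)], of "(0, i)"] by simp
  qed (rule zero)
  show ?thesis using assms(3)[OF 1[of "fst q"] 2[of "snd q"]] by simp
qed

section \<open>A coarsely separating subgroup that is not virtually of codimension one\<close>

text \<open>The group is kept abstract, with a faithful action on the plane, because the example is required on
  the type of natural numbers.\<close>

locale almost_translation_action = group A for A (structure) +
  fixes act :: "'a \<Rightarrow> plane \<Rightarrow> plane"
  assumes act_mult: "g \<in> carrier A \<Longrightarrow> h \<in> carrier A \<Longrightarrow> act (g \<otimes> h) = act g \<circ> act h"
    and act_bij: "bij_betw act (carrier A) almost_translations"
begin

definition elt :: "(plane \<Rightarrow> plane) \<Rightarrow> 'a" where
  "elt = inv_into (carrier A) act"

definition disp :: "'a \<Rightarrow> plane" where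
  "disp g = displacement (act g)"

definition tr :: "plane \<Rightarrow> plane \<Rightarrow> 'a" where
  "tr x y = elt (transpose x y)"

definition shift :: "plane \<Rightarrow> 'a" where
  "shift q = elt (\<lambda>x. x + q)"

definition finitary :: "'a set" where
  "finitary = {g \<in> carrier A. disp g = 0}"

definition std_gens :: "'a set" where
  "std_gens = {shift (1, 0), shift (0, 1), tr 0 (1, 0), tr 0 (0, 1)}"

lemma act_in: "g \<in> carrier A \<Longrightarrow> act g \<in> almost_translations"
  using act_bij bij_betwE by blast

lemma elt: "f \<in> almost_translations \<Longrightarrow> elt f \<in> carrier A" "f \<in> almost_translations \<Longrightarrow> act (elt f) = f"
  unfolding elt_def using act_bij by (auto simp: bij_betw_def inv_into_into f_inv_into_f)

lemma act_inject: "g \<in> carrier A \<Longrightarrow> h \<in> carrier A \<Longrightarrow> act g = act h \<Longrightarrow> g = h"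
  using act_bij by (auto simp: bij_betw_def inj_on_def)

lemma act_bij_plane: "g \<in> carrier A \<Longrightarrow> bij (act g)"
  using act_in almost_translationsD by blast

lemma act_one: "act \<one> = id"
proof -
  have "act \<one> \<circ> act \<one> = act \<one>" using act_mult[OF one_closed one_closed] by simp
  then have "act \<one> (act \<one> x) = act \<one> x" for x by (metis comp_apply)
  then show ?thesis using act_bij_plane[OF one_closed] by (metis bij_is_inj eq_id_iff injD)
qed

lemma disp_mult: "g \<in> carrier A \<Longrightarrow> h \<in> carrier A \<Longrightarrow> disp (g \<otimes> h) = disp g + disp h"
  unfolding disp_def by (simp add: act_mult almost_translations_comp act_in)

lemma disp_one: "disp \<one> = 0"
  using disp_mult[OF one_closed one_closed] by simp

lemma disp_inv: "g \<in> carrier A \<Longrightarrow> disp (inv g) = - disp g"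
  using disp_mult[of g "inv g"] disp_one by (simp add: eq_neg_iff_add_eq_0 add.commute)

lemma tr_closed: "tr x y \<in> carrier A" and act_tr: "act (tr x y) = transpose x y"
  and disp_tr: "disp (tr x y) = 0"
  unfolding disp_def tr_def using elt transpose_almost_translation by simp_all

lemma shift_closed: "shift q \<in> carrier A" and act_shift: "act (shift q) = (\<lambda>x. x + q)"
  and disp_shift: "disp (shift q) = q"
  unfolding disp_def shift_def using elt translation_almost_translation by simp_all

lemma tr_in_finitary: "tr x y \<in> finitary"
  unfolding finitary_def using tr_closed disp_tr by simp

lemma finitary_subgroup: "subgroup finitary A"
  by (rule subgroupI) (auto simp: finitary_def disp_mult disp_inv disp_one intro: one_closed)

lemma finitary_closed: "g \<in> finitary \<Longrightarrow> g \<in> carrier A"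
  unfolding finitary_def by simp

lemma tr_commute: "tr x y = tr y x"
  unfolding tr_def by (simp add: transpose_commute)

lemma tr_tr: "tr x y \<otimes> tr x y = \<one>"
  by (rule act_inject) (simp_all add: tr_closed act_mult act_tr act_one)

lemma tr_inv: "inv (tr x y) = tr x y"
  using inv_equality[OF tr_tr tr_closed tr_closed] .

lemma mult_tr: "g \<in> carrier A \<Longrightarrow> g \<otimes> tr x y = tr (act g x) (act g y) \<otimes> g"
proof (rule act_inject)
  assume g: "g \<in> carrier A"
  show "act (g \<otimes> tr x y) = act (tr (act g x) (act g y) \<otimes> g)"
    using transpose_comp_eq[OF act_bij_plane[OF g], of "act g x" "act g y"] bij_is_inj[OF act_bij_plane[OF g]]
    by (simp add: act_mult g tr_closed act_tr)
qed (simp_all add: tr_closed)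

lemma conj_tr: "g \<in> carrier A \<Longrightarrow> g \<otimes> tr x y \<otimes> inv g = tr (act g x) (act g y)"
  using mult_tr[of g x y] by (simp add: tr_closed m_assoc)

lemma shift_add: "shift (q + r) = shift q \<otimes> shift r"
  by (rule act_inject) (auto simp: shift_closed act_mult act_shift fun_eq_iff algebra_simps)

lemma shift_zero: "shift 0 = \<one>"
  by (rule act_inject) (auto simp: shift_closed act_shift act_one)

lemma shift_uminus: "shift (- q) = inv (shift q)"
proof -
  have "shift (- q) \<otimes> shift q = \<one>" using shift_add[of "- q" q] shift_zero by simp
  then show ?thesis using inv_equality shift_closed by metis
qed

lemma finitary_induct [consumes 1, case_names one tr]:
  assumes g: "g \<in> finitary" and one: "Q \<one>"
    and tr: "\<And>x y g. x \<noteq> y \<Longrightarrow> g \<in> finitary \<Longrightarrow> Q g \<Longrightarrow> Q (tr x y \<otimes> g)"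
  shows "Q g"
proof -
  have gA: "g \<in> carrier A" using g finitary_closed by auto
  \<comment> \<open>The induction takes place on the permutation \<open>act g\<close> and is transported back by injectivity.\<close>
  have "finite {x. act g x \<noteq> x}"
    using almost_translationsD(2)[OF act_in[OF gA]] g unfolding translation_off_finite_def finitary_def disp_def by simp
  moreover have "act g permutes {x. act g x \<noteq> x}"
    using act_bij_plane[OF gA] unfolding permutes_def bij_iff by blast
  moreover have "\<exists>h \<in> finitary. act h = p \<and> Q h" if "p permutes F" "finite F" for p F
    using that
  proof (induction rule: permutes_induct)
    case id
    show ?case using one act_one subgroup.one_closed[OF finitary_subgroup] by (intro bexI[of _ \<one>]) simp_all
  next
    case (swap a b p)
    then obtain h where h: "h \<in> finitary" "act h = p" "Q h" by auto
    then have "tr a b \<otimes> h \<in> finitary" "act (tr a b \<otimes> h) = transpose a b \<circ> p" "Q (tr a b \<otimes> h)"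
      using tr[OF swap(3)] subgroup.m_closed[OF finitary_subgroup tr_in_finitary] act_mult[OF tr_closed finitary_closed]
      by (simp_all add: act_tr)
    then show ?case by blast
  qed
  ultimately obtain h where "h \<in> finitary" "act h = act g" "Q h" by blast
  then show ?thesis using act_inject[OF finitary_closed gA] by metis
qed

lemma std_gens_closed: "std_gens \<subseteq> carrier A"
  unfolding std_gens_def using tr_closed shift_closed by auto

text \<open>The relation "\<open>x = y\<close> or the transposition of \<open>x\<close> and \<open>y\<close> is generated" is an equivalence relation:
  transitivity is conjugation of one transposition by another. It contains all pairs of
  neighbours, which are translates of the two given transpositions, so it is total.\<close>

lemma generate_std_gens: "generate A std_gens = carrier A"
proof
  show "generate A std_gens \<subseteq> carrier A" using generate_incl[OF std_gens_closed] .
  let ?N = "generate A std_gens"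
  have N: "subgroup ?N A" using generate_is_subgroup[OF std_gens_closed] .
  note mult = subgroup.m_closed[OF N] and minv = subgroup.m_inv_closed[OF N]
  have std_gens: "t \<in> ?N" if "t \<in> std_gens" for t using generate.incl[OF that] .
  have shift: "shift q \<in> ?N" for q
  proof (induction q rule: plane_induct)
    case 1 show ?case using std_gens unfolding std_gens_def by simp
  next
    case 2 show ?case using std_gens unfolding std_gens_def by simp
  next
    case (3 a b) then show ?case using mult by (simp add: shift_add)
  next
    case (4 a) then show ?case using minv by (simp add: shift_uminus)
  qed
  define R where "R x y \<longleftrightarrow> x = y \<or> tr x y \<in> ?N" for x y
  have R_sym: "R x y \<Longrightarrow> R y x" for x y unfolding R_def using tr_commute by metis
  have R_trans: "R x z" if xy: "R x y" and yz: "R y z" for x y z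
  proof (cases "x = y \<or> y = z \<or> x = z")
    case True
    then show ?thesis using xy yz unfolding R_def by auto
  next
    case False
    then have "tr x y \<in> ?N" "tr y z \<in> ?N" using xy yz unfolding R_def by auto
    then have "tr x y \<otimes> tr y z \<otimes> inv (tr x y) \<in> ?N" using mult minv by blast
    moreover have "tr x y \<otimes> tr y z \<otimes> inv (tr x y) = tr x z"
      using False conj_tr[OF tr_closed, of x y y z] by (auto simp: act_tr transpose_def)
    ultimately show ?thesis unfolding R_def by simp
  qed
  have R_translate: "R x (x + e)" if e: "tr 0 e \<in> std_gens" for x e
  proof -
    have "shift x \<otimes> tr 0 e \<otimes> inv (shift x) \<in> ?N" using mult minv shift std_gens[OF e] by blast
    moreover have "shift x \<otimes> tr 0 e \<otimes> inv (shift x) = tr x (x + e)"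
      using conj_tr[OF shift_closed, of x 0 e] by (simp add: act_shift add.commute)
    ultimately show ?thesis unfolding R_def by simp
  qed
  have R_all: "\<forall>x. R x (x + q)" for q
  proof (induction q rule: plane_induct)
    case 1 show ?case using R_translate unfolding std_gens_def by simp
  next
    case 2 show ?case using R_translate unfolding std_gens_def by simp
  next
    case (3 a b)
    then show ?case using R_trans by (metis add.assoc)
  next
    case (4 a)
    have "R (x + (- a)) (x + (- a) + a)" for x using 4 by blast
    then show ?case using R_sym by simp
  qed
  have tr_N: "tr x y \<in> ?N" if "x \<noteq> y" for x y
    using R_all[of "y - x"] that unfolding R_def by (metis add_diff_cancel_left' diff_add_cancel add.commute)
  have BN: "b \<in> ?N" if "b \<in> finitary" for b
    using that
  proof (induction rule: finitary_induct)
    case one show ?case using subgroup.one_closed[OF N] .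
  next
    case (tr x y g) then show ?case using mult tr_N by blast
  qed
  show "carrier A \<subseteq> ?N"
  proof
    fix g assume g: "g \<in> carrier A"
    have "g \<otimes> inv (shift (disp g)) \<in> finitary"
      unfolding finitary_def using g by (simp add: shift_closed disp_mult disp_inv disp_shift)
    then have "g \<otimes> inv (shift (disp g)) \<otimes> shift (disp g) \<in> ?N" using BN mult shift by blast
    then show "g \<in> ?N" using g by (simp add: shift_closed m_assoc)
  qed
qed

lemma finitely_generated: "finite_generating_set A std_gens"
  unfolding finite_generating_set_def using std_gens_closed generate_std_gens by (simp add: std_gens_def)

sublocale fin_gen_group A std_gens
  by unfold_locales (rule finitely_generated)

lemma near_finitary_finite_disp:
  assumes "near finitary U"
  shows "finite (disp ` U)"
proof -
  obtain F where F: "finite F" "F \<subseteq> carrier A" "U \<subseteq> (\<Union>f \<in> F. finitary #> f)" using assms unfolding near_def by auto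
  have "disp ` U \<subseteq> disp ` F"
  proof (rule image_subsetI)
    fix u assume "u \<in> U"
    then obtain f b where "f \<in> F" "b \<in> finitary" "u = b \<otimes> f" using F(3) unfolding r_coset_def by blast
    then show "disp u \<in> disp ` F" using F(2) disp_mult unfolding finitary_def by auto
  qed
  then show ?thesis using F(1) finite_subset by blast
qed

lemma finite_disp_near_finitary:
  assumes "U \<subseteq> carrier A" "finite (disp ` U)"
  shows "near finitary U"
proof -
  have "u \<in> finitary #> shift (disp u)" if u: "u \<in> U" for u
  proof -
    have uA: "u \<in> carrier A" using u assms(1) by auto
    then have "u \<otimes> inv (shift (disp u)) \<in> finitary"
      unfolding finitary_def by (simp add: shift_closed disp_mult disp_inv disp_shift)
    moreover have "u = u \<otimes> inv (shift (disp u)) \<otimes> shift (disp u)"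
      using uA by (simp add: shift_closed m_assoc)
    ultimately show ?thesis unfolding r_coset_def by blast
  qed
  then have "U \<subseteq> (\<Union>f \<in> shift ` disp ` U. finitary #> f)" by blast
  moreover have "shift ` disp ` U \<subseteq> carrier A" using shift_closed by auto
  ultimately show ?thesis using assms(2) unfolding near_def by blast
qed

text \<open>If \<open>g\<close> has displacement \<open>q\<close>, then \<open>g \<circ> transpose 0 e\<close> differs from \<open>g\<close> at \<open>- q\<close> only if \<open>- q\<close> is
  \<open>0\<close> or \<open>e\<close>, and \<open>g \<circ> shift r\<close> takes at \<open>- (q + r)\<close> the value that \<open>g\<close> takes at \<open>- q\<close>. So the value
  at \<open>- q\<close> can change only when the displacement takes one of three values.\<close>

lemma finitary_coarsely_separating: "coarsely_separating A std_gens finitary"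
proof -
  define P where "P = {g \<in> carrier A. act g (- disp g) = 0}"
  have "near finitary {g \<in> carrier A. (g \<in> P) \<noteq> (g \<otimes> t \<in> P)}" if "t \<in> std_gens" for t
  proof (rule finite_disp_near_finitary)
    have tA: "t \<in> carrier A" using that std_gens_closed by auto
    have sh: "g \<otimes> shift q \<in> P \<longleftrightarrow> g \<in> P" if "g \<in> carrier A" for g q
      unfolding P_def using that by (simp add: shift_closed disp_mult disp_shift act_mult act_shift)
    have tr: "g \<otimes> tr 0 e \<in> P \<longleftrightarrow> g \<in> P" if "g \<in> carrier A" "disp g \<notin> {0, - e}" for g e
    proof -
      have "- disp g \<noteq> 0" "- disp g \<noteq> e" using that(2) by auto
      then have "transpose 0 e (- disp g) = - disp g" by (simp add: transpose_def)
      then show ?thesis unfolding P_def using that(1)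
        by (simp add: tr_closed disp_mult disp_tr act_mult act_tr)
    qed
    have "disp ` {g \<in> carrier A. (g \<in> P) \<noteq> (g \<otimes> t \<in> P)} \<subseteq> {0, - (1, 0), - (0, 1)}"
    proof (rule image_subsetI)
      fix g assume g: "g \<in> {g \<in> carrier A. (g \<in> P) \<noteq> (g \<otimes> t \<in> P)}"
      then have gA: "g \<in> carrier A" and ne: "(g \<in> P) \<noteq> (g \<otimes> t \<in> P)" by auto
      show "disp g \<in> {0, - (1, 0), - (0, 1)}"
        using \<open>t \<in> std_gens\<close> ne sh[OF gA] tr[OF gA, of "(1, 0)"] tr[OF gA, of "(0, 1)"]
        unfolding std_gens_def by blast
    qed
    then show "finite (disp ` {g \<in> carrier A. (g \<in> P) \<noteq> (g \<otimes> t \<in> P)})" by (rule finite_subset) simp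
  qed auto
  moreover have "\<not> near finitary P"
  proof
    assume "near finitary P"
    then have "finite (disp ` P)" by (rule near_finitary_finite_disp)
    moreover have "shift q \<in> P" for q unfolding P_def by (simp add: shift_closed act_shift disp_shift)
    then have "UNIV \<subseteq> disp ` P" by (metis disp_shift image_eqI subsetI)
    ultimately show False using infinite_plane finite_subset by blast
  qed
  moreover have "\<not> near finitary (carrier A - P)"
  proof
    assume "near finitary (carrier A - P)"
    then have "finite (disp ` (carrier A - P))" by (rule near_finitary_finite_disp)
    moreover have "tr 0 (1, 0) \<otimes> shift q \<in> carrier A - P" "disp (tr 0 (1, 0) \<otimes> shift q) = q" for q
      unfolding P_def
      by (simp_all add: shift_closed act_shift disp_shift tr_closed act_tr disp_tr disp_mult act_mult zero_prod_def)
    then have "UNIV \<subseteq> disp ` (carrier A - P)" by (metis image_eqI subsetI)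
    ultimately show False using infinite_plane finite_subset by blast
  qed
  ultimately have "cut finitary P" unfolding cut_def P_def by blast
  then show ?thesis by (rule cut_imp_coarsely_separating[OF finitary_subgroup])
qed

lemma finitary_transitive_on_triples:
  assumes "x \<noteq> y" "x \<noteq> z" "y \<noteq> z" "x' \<noteq> y'" "x' \<noteq> z'" "y' \<noteq> z'"
  shows "\<exists>h \<in> finitary. act h x = x' \<and> act h y = y' \<and> act h z = z'"
proof -
  define y1 z1 where "y1 = transpose x x' y" and "z1 = transpose x x' z"
  define z2 where "z2 = transpose y1 y' z1"
  have ne1: "y1 \<noteq> x'" "z1 \<noteq> x'" "y1 \<noteq> z1"
    using assms unfolding y1_def z1_def by (auto simp: transpose_def)
  have ne2: "z2 \<noteq> x'" "z2 \<noteq> y'"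
    using assms ne1 unfolding z2_def by (auto simp: transpose_def)
  let ?h = "tr z2 z' \<otimes> (tr y1 y' \<otimes> tr x x')"
  have act: "act ?h w = transpose z2 z' (transpose y1 y' (transpose x x' w))" for w
    by (simp add: act_mult tr_closed act_tr)
  have "act ?h x = x'" "act ?h y = y'" "act ?h z = z'"
    unfolding act using assms ne1 ne2
    by (simp_all add: y1_def[symmetric] z1_def[symmetric] z2_def[symmetric] transpose_apply_other)
  moreover have "?h \<in> finitary" using subgroup.m_closed[OF finitary_subgroup] tr_in_finitary by blast
  ultimately show ?thesis by blast
qed

text \<open>The normal core \<open>N\<close> of \<open>K\<close> contains a product \<open>(0 x)(0 y)\<close> with \<open>x \<noteq> y\<close>, by the pigeonhole
  principle. Conjugation gives all \<open>(u v)(u w)\<close>, and these give all products of two transpositions. So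
  \<open>N\<close> has index at most two, and multiplication by any transposition takes an element outside \<open>N\<close>
  into \<open>N\<close>.\<close>

lemma finite_index_in_finitary:
  assumes K: "finite_index_subgroup K (A\<lparr>carrier := finitary\<rparr>)" and b: "b \<in> finitary"
  shows "b \<in> K \<or> (\<forall>u v. u \<noteq> v \<longrightarrow> b \<otimes> tr u v \<in> K)"
proof -
  define N where "N = {n \<in> finitary. \<forall>h \<in> finitary. h \<otimes> n \<otimes> inv h \<in> K}"
  note K' = finite_index_subgroupD[OF finitary_subgroup K]
  note Bm = subgroup.m_closed[OF finitary_subgroup] and Bi = subgroup.m_inv_closed[OF finitary_subgroup]
    and B1 = subgroup.one_closed[OF finitary_subgroup]
  have NK: "n \<in> K" if "n \<in> N" for n
    using that B1 finitary_closed unfolding N_def by force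
  have N_one: "\<one> \<in> N" unfolding N_def using B1 finitary_closed subgroup.one_closed[OF K'(1)] by simp
  have N_mult: "m \<otimes> n \<in> N" if "m \<in> N" "n \<in> N" for m n
  proof -
    have mn: "m \<in> finitary" "n \<in> finitary" using that unfolding N_def by auto
    have "h \<otimes> (m \<otimes> n) \<otimes> inv h \<in> K" if h: "h \<in> finitary" for h
    proof -
      have "(h \<otimes> m \<otimes> inv h) \<otimes> (h \<otimes> n \<otimes> inv h) \<in> K"
        using subgroup.m_closed[OF K'(1)] \<open>m \<in> N\<close> \<open>n \<in> N\<close> h unfolding N_def by blast
      moreover have "(h \<otimes> m \<otimes> inv h) \<otimes> (h \<otimes> n \<otimes> inv h) = h \<otimes> (m \<otimes> n) \<otimes> inv h"
        using conj_mult mn h finitary_closed by simp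
      ultimately show ?thesis by simp
    qed
    then show ?thesis unfolding N_def using mn Bm by auto
  qed
  have N_conj: "g \<otimes> n \<otimes> inv g \<in> N" if g: "g \<in> finitary" and n: "n \<in> N" for g n
  proof -
    have nB: "n \<in> finitary" using n unfolding N_def by auto
    have "h \<otimes> (g \<otimes> n \<otimes> inv g) \<otimes> inv h \<in> K" if h: "h \<in> finitary" for h
    proof -
      have "(h \<otimes> g) \<otimes> n \<otimes> inv (h \<otimes> g) \<in> K" using Bm[OF h g] n unfolding N_def by auto
      moreover have "(h \<otimes> g) \<otimes> n \<otimes> inv (h \<otimes> g) = h \<otimes> (g \<otimes> n \<otimes> inv g) \<otimes> inv h"
        using g h nB finitary_closed by (simp add: m_assoc inv_mult_group)
      ultimately show ?thesis by simp
    qed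
    then show ?thesis unfolding N_def using Bm Bi g nB by auto
  qed
  have "infinite (- {0 :: plane})" using infinite_plane by (simp add: Compl_eq_Diff_UNIV)
  from finite_index_core_pair[OF finitary_subgroup K this, of "\<lambda>x. tr 0 x"] tr_in_finitary
  obtain x y where "x \<in> - {0}" "y \<in> - {0}" "x \<noteq> y"
    and core: "\<forall>h \<in> finitary. h \<otimes> (tr 0 x \<otimes> inv (tr 0 y)) \<otimes> inv h \<in> K" by blast
  then have xy: "x \<noteq> 0" "y \<noteq> 0" "x \<noteq> y" by simp_all
  have base: "tr 0 x \<otimes> tr 0 y \<in> N" unfolding N_def using core Bm tr_in_finitary by (simp add: tr_inv)
  have three: "tr u v \<otimes> tr u w \<in> N" if uvw: "u \<noteq> v" "u \<noteq> w" "v \<noteq> w" for u v w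
  proof -
    obtain h where h: "h \<in> finitary" "act h 0 = u" "act h x = v" "act h y = w"
      using finitary_transitive_on_triples[of 0 x y u v w] uvw xy by auto
    have hA: "h \<in> carrier A" using h finitary_closed by auto
    have "h \<otimes> (tr 0 x \<otimes> tr 0 y) \<otimes> inv h = (h \<otimes> tr 0 x \<otimes> inv h) \<otimes> (h \<otimes> tr 0 y \<otimes> inv h)"
      using conj_mult[OF hA tr_closed tr_closed] by simp
    also have "\<dots> = tr u v \<otimes> tr u w" using conj_tr[OF hA] h by simp
    finally show ?thesis using N_conj[OF h(1) base] by simp
  qed
  have even: "tr u v \<otimes> tr w z \<in> N" if "u \<noteq> v" "w \<noteq> z" for u v w z
  proof -
    have shared: "tr a b \<otimes> tr a c \<in> N" if "a \<noteq> b" "a \<noteq> c" for a b c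
      using that three[of a b c] tr_tr N_one by (cases "b = c") auto
    consider "u = w" | "u = z" | "v = w" | "v = z" | "u \<noteq> w" "u \<noteq> z" "v \<noteq> w" "v \<noteq> z" by blast
    then show ?thesis
    proof cases
      case 5
      have "(tr u v \<otimes> tr u w) \<otimes> (tr w u \<otimes> tr w z) \<in> N"
        using N_mult shared that 5 by metis
      moreover have "(tr u v \<otimes> tr u w) \<otimes> (tr w u \<otimes> tr w z) = tr u v \<otimes> ((tr u w \<otimes> tr u w) \<otimes> tr w z)"
        by (simp add: m_assoc tr_closed tr_commute[of w u])
      ultimately show ?thesis by (simp add: tr_tr tr_closed)
    qed (use shared[of u v z] shared[of u v w] shared[of v u z] shared[of v u w] that tr_commute in metis)+
  qed
  have "b \<in> N \<or> (\<forall>u v. u \<noteq> v \<longrightarrow> b \<otimes> tr u v \<in> N)"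
    using b
  proof (induction rule: finitary_induct)
    case one
    then show ?case using N_one by simp
  next
    case (tr x y g)
    have gA: "g \<in> carrier A" using tr finitary_closed by auto
    show ?case
    proof (cases "g \<in> N")
      case True
      have "tr x y \<otimes> g \<otimes> tr u v \<in> N" if "u \<noteq> v" for u v
      proof -
        have "(tr x y \<otimes> tr u v) \<otimes> (tr u v \<otimes> g \<otimes> inv (tr u v)) \<in> N"
          by (rule N_mult[OF even[OF tr(1) that] N_conj[OF tr_in_finitary True]])
        moreover have "(tr x y \<otimes> tr u v) \<otimes> (tr u v \<otimes> g \<otimes> inv (tr u v))
            = tr x y \<otimes> ((tr u v \<otimes> tr u v) \<otimes> (g \<otimes> tr u v))"
          by (simp add: m_assoc tr_closed gA tr_inv)
        ultimately show ?thesis by (simp add: tr_tr tr_closed gA m_assoc)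
      qed
      then show ?thesis by blast
    next
      case False
      then have "g \<otimes> tr x y \<in> N" using tr by blast
      then have "tr x y \<otimes> (g \<otimes> tr x y) \<otimes> inv (tr x y) \<in> N" using N_conj tr_in_finitary by blast
      moreover have "tr x y \<otimes> (g \<otimes> tr x y) \<otimes> inv (tr x y) = (tr x y \<otimes> g) \<otimes> (tr x y \<otimes> tr x y)"
        by (simp add: m_assoc tr_closed gA tr_inv)
      ultimately show ?thesis by (simp add: tr_tr tr_closed gA)
    qed
  qed
  then show ?thesis using NK by blast
qed

text \<open>Let \<open>P\<close> be an invariant cut. Its boundary has displacements in a box. Outside the box, horizontal and
  vertical lines connect every displacement to one corner point \<open>c\<close> without entering the box, and any two
  elements over \<open>c\<close> differ by an element of \<open>K\<close> or by one of \<open>K\<close> times a transposition.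
  The latter can be chosen as a conjugate of a generator, so that it turns into right multiplication by that
  generator. Hence \<open>P\<close> contains all or none of the elements with displacement outside
  the box, and the elements with displacement in the box are near \<open>K\<close>.\<close>

lemma not_codimension_one_of_finite_index:
  assumes K: "finite_index_subgroup K (A\<lparr>carrier := finitary\<rparr>)"
  shows "\<not> codimension_one A std_gens K"
proof
  note K' = finite_index_subgroupD[OF finitary_subgroup K]
  assume "codimension_one A std_gens K"
  then obtain P where cut: "cut K P" and inv: "left_invariant K P"
    unfolding codimension_one_iff_invariant_cut[OF K'(1)] by auto
  have P: "P \<subseteq> carrier A" using cut unfolding cut_def by auto
  define bd where "bd t = {g \<in> carrier A. (g \<in> P) \<noteq> (g \<otimes> t \<in> P)}" for t
  have "finite (disp ` bd t)" if "t \<in> std_gens" for t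
  proof -
    have "near K (bd t)" using cut that unfolding cut_def bd_def by auto
    then show ?thesis using near_finitary_finite_disp near_subset_subgroup K'(2) by blast
  qed
  then have "finite (\<Union>t \<in> std_gens. disp ` bd t)" unfolding std_gens_def by simp
  then obtain n where n: "(\<Union>t \<in> std_gens. disp ` bd t) \<subseteq> {q. \<bar>fst q\<bar> \<le> n \<and> \<bar>snd q\<bar> \<le> n}"
    using finite_in_plane_box by blast
  define far where "far q \<longleftrightarrow> \<not> (\<bar>fst q\<bar> \<le> n \<and> \<bar>snd q\<bar> \<le> n)" for q :: plane
  have step: "g \<in> P \<longleftrightarrow> g \<otimes> t \<in> P" if "g \<in> carrier A" "far (disp g)" "t \<in> std_gens" for g t
    using n that unfolding far_def bd_def by blast
  have along: "g \<in> P \<longleftrightarrow> g \<otimes> shift (k * fst d, k * snd d) \<in> P"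
    if g: "g \<in> carrier A" and d: "shift d \<in> std_gens" and f: "\<And>k. far (disp g + (k * fst d, k * snd d))" for g d k
  proof (induction k rule: int_induct[where k = 0])
    case base
    show ?case using g shift_zero by (simp add: zero_prod_def)
  next
    case (step1 i)
    have "((i + 1) * fst d, (i + 1) * snd d) = (i * fst d, i * snd d) + d"
      by (simp add: prod_eq_iff algebra_simps)
    then have "g \<otimes> shift ((i + 1) * fst d, (i + 1) * snd d) = g \<otimes> shift (i * fst d, i * snd d) \<otimes> shift d"
      using g by (simp add: shift_add m_assoc shift_closed)
    then show ?case using step1 step[OF _ _ d, of "g \<otimes> shift (i * fst d, i * snd d)"] g f[of i]
      by (simp add: shift_closed disp_mult disp_shift)
  next
    case (step2 i)
    have "(i * fst d, i * snd d) = ((i - 1) * fst d, (i - 1) * snd d) + d"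
      by (simp add: prod_eq_iff algebra_simps)
    then have "g \<otimes> shift (i * fst d, i * snd d) = g \<otimes> shift ((i - 1) * fst d, (i - 1) * snd d) \<otimes> shift d"
      using g by (simp add: shift_add m_assoc shift_closed)
    then show ?case using step2 step[OF _ _ d, of "g \<otimes> shift ((i - 1) * fst d, (i - 1) * snd d)"] g f[of "i - 1"]
      by (simp add: shift_closed disp_mult disp_shift)
  qed
  have horizontal: "g \<in> P \<longleftrightarrow> g \<otimes> shift (k, 0) \<in> P"
    if "g \<in> carrier A" "n < \<bar>snd (disp g)\<bar>" for g k
    using along[of g "(1, 0)" k] that by (simp add: std_gens_def far_def)
  have vertical: "g \<in> P \<longleftrightarrow> g \<otimes> shift (0, k) \<in> P"
    if "g \<in> carrier A" "n < \<bar>fst (disp g)\<bar>" for g k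
    using along[of g "(0, 1)" k] that by (simp add: std_gens_def far_def)
  \<comment> \<open>The absolute value makes \<open>c\<close> lie outside the box even if \<open>n\<close> is negative.\<close>
  define c where "c = (\<bar>n\<bar> + 1, \<bar>n\<bar> + 1)"
  have far_c: "far c" unfolding far_def c_def by simp
  have to_corner: "\<exists>g' \<in> carrier A. disp g' = c \<and> (g \<in> P \<longleftrightarrow> g' \<in> P)"
    if g: "g \<in> carrier A" "far (disp g)" for g
  proof (cases "n < \<bar>fst (disp g)\<bar>")
    case True
    define g1 where "g1 = g \<otimes> shift (0, \<bar>n\<bar> + 1 - snd (disp g))"
    have g1: "g1 \<in> carrier A" "disp g1 = (fst (disp g), \<bar>n\<bar> + 1)"
      unfolding g1_def using g by (simp_all add: shift_closed disp_mult disp_shift prod_eq_iff)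
    define g2 where "g2 = g1 \<otimes> shift (\<bar>n\<bar> + 1 - fst (disp g1), 0)"
    have "g2 \<in> carrier A" "disp g2 = c"
      unfolding g2_def c_def using g1 by (simp_all add: shift_closed disp_mult disp_shift prod_eq_iff)
    moreover have "g \<in> P \<longleftrightarrow> g1 \<in> P" unfolding g1_def by (rule vertical[OF g(1) True])
    moreover have "g1 \<in> P \<longleftrightarrow> g2 \<in> P" unfolding g2_def by (rule horizontal[OF g1(1)]) (simp add: g1)
    ultimately show ?thesis by blast
  next
    case False
    then have *: "n < \<bar>snd (disp g)\<bar>" using g(2) unfolding far_def by auto
    define g1 where "g1 = g \<otimes> shift (\<bar>n\<bar> + 1 - fst (disp g), 0)"
    have g1: "g1 \<in> carrier A" "disp g1 = (\<bar>n\<bar> + 1, snd (disp g))"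
      unfolding g1_def using g by (simp_all add: shift_closed disp_mult disp_shift prod_eq_iff)
    define g2 where "g2 = g1 \<otimes> shift (0, \<bar>n\<bar> + 1 - snd (disp g1))"
    have "g2 \<in> carrier A" "disp g2 = c"
      unfolding g2_def c_def using g1 by (simp_all add: shift_closed disp_mult disp_shift prod_eq_iff)
    moreover have "g \<in> P \<longleftrightarrow> g1 \<in> P" unfolding g1_def by (rule horizontal[OF g(1) *])
    moreover have "g1 \<in> P \<longleftrightarrow> g2 \<in> P" unfolding g2_def by (rule vertical[OF g1(1)]) (simp add: g1)
    ultimately show ?thesis by blast
  qed
  have corner: "g' \<in> P" if g: "g \<in> P" "disp g = c" and g': "g' \<in> carrier A" "disp g' = c" for g g'
  proof -
    have gA: "g \<in> carrier A" using g P by auto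
    have "g' \<otimes> inv g \<in> finitary" unfolding finitary_def using gA g g' by (simp add: disp_mult disp_inv)
    from finite_index_in_finitary[OF K this] show ?thesis
    proof
      assume "g' \<otimes> inv g \<in> K"
      then have "g' \<otimes> inv g \<otimes> g \<in> P" using inv g unfolding left_invariant_def by blast
      then show ?thesis using gA g' by (simp add: m_assoc)
    next
      assume odd: "\<forall>u v. u \<noteq> v \<longrightarrow> g' \<otimes> inv g \<otimes> tr u v \<in> K"
      let ?e = "(1, 0) :: plane"
      have "act g 0 \<noteq> act g ?e" using bij_is_inj[OF act_bij_plane[OF gA]] by (auto simp: inj_eq zero_prod_def)
      then have k: "g' \<otimes> inv g \<otimes> tr (act g 0) (act g ?e) \<in> K" using odd by blast
      have t: "tr 0 ?e \<in> std_gens" unfolding std_gens_def by simp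
      have "g \<otimes> tr 0 ?e \<in> P" using step[OF gA _ t] g far_c by simp
      then have "(g' \<otimes> inv g \<otimes> tr (act g 0) (act g ?e)) \<otimes> (g \<otimes> tr 0 ?e) \<in> P"
        using inv k unfolding left_invariant_def by blast
      moreover have "(g' \<otimes> inv g \<otimes> tr (act g 0) (act g ?e)) \<otimes> (g \<otimes> tr 0 ?e)
          = g' \<otimes> inv g \<otimes> ((tr (act g 0) (act g ?e) \<otimes> tr (act g 0) (act g ?e)) \<otimes> g)"
        unfolding mult_tr[OF gA] using gA g' by (simp add: m_assoc tr_closed)
      ultimately show ?thesis using gA g' by (simp add: tr_tr m_assoc)
    qed
  qed
  have near_box: "near K U" if "U \<subseteq> carrier A" "\<And>u. u \<in> U \<Longrightarrow> \<not> far (disp u)" for U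
  proof -
    have "disp ` U \<subseteq> {q. \<bar>fst q\<bar> \<le> n \<and> \<bar>snd q\<bar> \<le> n}" using that(2) unfolding far_def by blast
    then have "near finitary U" using finite_disp_near_finitary[OF that(1)] finite_plane_box finite_subset by blast
    then show ?thesis by (rule near_trans[OF subgroup.subset[OF finitary_subgroup] subgroup.subset[OF K'(1)] K'(3)])
  qed
  have "g' \<in> P" if g: "g \<in> P" "far (disp g)" and g': "g' \<in> carrier A" "far (disp g')" for g g'
  proof -
    obtain h where h: "h \<in> carrier A" "disp h = c" "g \<in> P \<longleftrightarrow> h \<in> P" using to_corner[of g] g P by blast
    obtain h' where h': "h' \<in> carrier A" "disp h' = c" "g' \<in> P \<longleftrightarrow> h' \<in> P" using to_corner[OF g'] by blast
    show ?thesis using corner[of h h'] g h h' by blast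
  qed
  then have "(\<forall>u \<in> P. \<not> far (disp u)) \<or> (\<forall>u \<in> carrier A - P. \<not> far (disp u))" by blast
  then have "near K P \<or> near K (carrier A - P)" using near_box[of P] near_box[of "carrier A - P"] P by blast
  then show False using cut unfolding cut_def by blast
qed

end

lemma coarsely_separating_without_virtual_codimension_one:
  "\<exists>(A :: nat monoid) T B. group A \<and> finite_generating_set A T \<and> subgroup B A
     \<and> coarsely_separating A T B
     \<and> \<not> (\<exists>K. finite_index_subgroup K (A\<lparr>carrier := B\<rparr>) \<and> codimension_one A T K)"
proof -
  let ?code = "to_nat_on almost_translations"
  let ?G = "almost_translation_group"
  let ?A = "image_group ?code ?G"
  interpret G: group ?G by (rule group_almost_translation_group)
  have carrier: "carrier ?G = almost_translations" unfolding almost_translation_group_def by simp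
  have inj: "inj_on ?code (carrier ?G)"
    unfolding carrier by (rule inj_on_to_nat_on[OF countable_almost_translations])
  interpret A: group ?A by (rule G.inj_imp_image_group_is_group[OF inj])
  interpret almost_translation_action ?A "inv_into almost_translations ?code"
  proof
    fix g h assume "g \<in> carrier ?A" "h \<in> carrier ?A"
    then have gh: "g \<in> ?code ` almost_translations" "h \<in> ?code ` almost_translations"
      unfolding image_group_carrier carrier by auto
    let ?i = "inv_into almost_translations ?code"
    have i: "?i g \<in> almost_translations" "?i h \<in> almost_translations" using gh by (auto intro: inv_into_into)
    have "g \<otimes>\<^bsub>?A\<^esub> h = ?code (?i g \<circ> ?i h)"
      unfolding image_group_def almost_translation_group_def by simp
    then show "?i (g \<otimes>\<^bsub>?A\<^esub> h) = ?i g \<circ> ?i h"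
      using inv_into_f_f[OF inj[unfolded carrier] almost_translations_comp(1)[OF i]] by simp
  next
    show "bij_betw (inv_into almost_translations ?code) (carrier ?A) almost_translations"
      unfolding image_group_carrier carrier
      by (rule bij_betw_inv_into) (simp add: bij_betw_def inj[unfolded carrier])
  qed
  show ?thesis
    using A.group_axioms finitely_generated finitary_subgroup finitary_coarsely_separating not_codimension_one_of_finite_index
    by blast
qed

section \<open>Codimension one and coarse separation\<close>

theorem theorem1p4:
  fixes G :: "('a, 'b) monoid_scheme" and S H :: "'a set"
  assumes "group G" and "finite_generating_set G S" and "subgroup H G"
  shows "(codimension_one G S H \<longrightarrow> coarsely_separating G S H)
    \<and> (Finite 2 \<le> relative_coends G S H \<and> relative_coends G S H \<le> Omega
        \<longrightarrow> virtually_codimension_one G S H)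
    \<and> (ERF (G\<lparr>carrier := H\<rparr>)
        \<longrightarrow> (coarsely_separating G S H \<longleftrightarrow> virtually_codimension_one G S H))
    \<and> (coarsely_separating G S H \<longrightarrow> (\<exists>K. K \<subseteq> H \<and> codimension_one G S K))
    \<and> (\<exists>(A :: nat monoid) T B. group A \<and> finite_generating_set A T \<and> subgroup B A
        \<and> coarsely_separating A T B
        \<and> \<not> (\<exists>K. finite_index_subgroup K (A\<lparr>carrier := B\<rparr>) \<and> codimension_one A T K))"
proof -
  interpret fin_gen_group G S
    using assms(1,2) by (intro fin_gen_group.intro fin_gen_group_axioms.intro)
  note H = \<open>subgroup H G\<close>
  have 1: "codimension_one G S H \<longrightarrow> coarsely_separating G S H"
    using codimension_one_imp_coarsely_separating by blast
  have 2: "Finite 2 \<le> relative_coends G S H \<and> relative_coends G S H \<le> Omega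
      \<longrightarrow> virtually_codimension_one G S H"
    using finite_coends_imp_virtually_codimension_one[OF H] by blast
  have 3: "ERF (G\<lparr>carrier := H\<rparr>)
      \<longrightarrow> (coarsely_separating G S H \<longleftrightarrow> virtually_codimension_one G S H)"
    using ERF_coarsely_separating_imp_virtually_codimension_one[OF H]
      virtually_codimension_one_imp_coarsely_separating[OF H] by blast
  have 4: "coarsely_separating G S H \<longrightarrow> (\<exists>K. K \<subseteq> H \<and> codimension_one G S K)"
    using coarsely_separating_contains_codimension_one by blast
  show ?thesis
    using 1 2 3 4 coarsely_separating_without_virtual_codimension_one by (intro conjI)
qed

end
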